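(* Let $n \geq 2$. If $(\mathcal{Q},\mathcal{P})$ is a misère quotient that is a one-stage extension of $\mathcal{T}_n$ and $|\mathcal{P}| = 2$, then either $(\mathcal{Q},\mathcal{P}) \cong \mathcal{T}_{n+1}$ or $(\mathcal{Q},\mathcal{P}) \cong \mathcal{R}_{2^n+4}$.
   Context: Impartial games, misère outcomes, closed sets of games and misère quotients: a game is the set of its options; $0=\emptyset$; $G+H$ has options $G'+H$, $G+H'$; $G$ is a (misère) $\mathscr{P}$-position iff $G\ne0$ and all options are $\mathscr{N}$-positions. A set of games is closed if it contains $0$ and is closed under options and sums. For closed $\mathscr{A}$, $G\equiv_\mathscr{A}H$ iff $G+X,H+X$ have the same outcome for all $X\in\mathscr{A}$; $\mathcal{Q}(\mathscr{A})=\mathscr{A}/{\equiv_\mathscr{A}}$ with distinguished subset the classes of $\mathscr{P}$-positions. A bipartite monoid is a commutative monoid $\mathcal{Q}$ with a distinguished subset $\mathcal{P}$; isomorphisms preserve the subset; it is a misère quotient if isomorphic to some $\mathcal{Q}(\mathscr{A})$. Two elements $x,y$ of a bipartite monoid are indistinguishable if $xw\in\mathcal{P}\Leftrightarrow yw\in\mathcal{P}$ for all $w$; the reduction is the quotient by this congruence, and the bipartite monoid is reduced if this congruence is equality. $(\mathcal{S},\mathcal{R})$ is a sub-b.m. of $(\mathcal{Q}^+,\mathcal{P}^+)$ if $\mathcal{S}$ is a submonoid and $\mathcal{R}=\mathcal{P}^+\cap\mathcal{S}$. For reduced $(\mathcal{Q},\mathcal{P})$, $(\mathcal{Q}^+,\mathcal{P}^+)$: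 the latter is an extension of the former if there is a sub-b.m. $(\mathcal{S},\mathcal{R})$ of $(\mathcal{Q}^+,\mathcal{P}^+)$ whose reduction is isomorphic to $(\mathcal{Q},\mathcal{P})$; it is a one-stage extension if moreover $\mathcal{Q}^+$ is generated by $\mathcal{S}\cup\{x\}$ for a single $x\in\mathcal{Q}^+\setminus\mathcal{S}$. For $k\ge2$, $\mathcal{T}_k$ has distinct elements $1,a,z_0,\ldots,z_{2^k-1}$, identity $1$, $a^2=1$, $z_iz_j=z_{i\oplus j}$, $az_i=z_{i\oplus1}$ ($\oplus$ = bitwise XOR), distinguished subset $\{a,z_0\}$. $\mathcal{R}_{2^k+4}$ has underlying set $\mathcal{T}_k\cup\{t,at\}$ with multiplication extending that of $\mathcal{T}_k$ by $t\cdot1=t$, $t\cdot a=at$, $t^2=z_0$, $tz_i=z_i$ (hence $(at)a=t$, $(at)t=z_1$, $(at)^2=z_0$, $(at)z_i=z_{i\oplus1}$), distinguished subset $\{a,z_0\}$. *)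

theory Defs
  imports "HOL-Library.FSet" "HOL-Algebra.Coset"
begin

section \<open>Impartial games and misere outcomes\<close>

text \<open>
  As usual in the theory of misere quotients, games are finite: a game is a hereditarily finite
  well-founded set, so that two games are equal iff they have the same options.
\<close>

datatype game = Game (options: "game fset")

definition zero_game :: game where
  "zero_game = Game {||}"

lemma fimage_fundef_cong [fundef_cong]:
  "A = B \<Longrightarrow> (\<And>x. x |\<in>| B \<Longrightarrow> f x = g x) \<Longrightarrow> f |`| A = g |`| B"
  by (rule fset.map_cong)

lemma size_option_less [termination_simp]:
  fixes x :: game
  shows "x |\<in>| Gs \<Longrightarrow> size x < Suc (\<Sum>y\<in>fset Gs. Suc (size y))"
  using member_le_sum[of x "fset Gs" "\<lambda>y. Suc (size y)"] by simp

fun game_add :: "game \<Rightarrow> game \<Rightarrow> game" where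
  "game_add (Game Gs) (Game Hs) =
     Game ((\<lambda>G'. game_add G' (Game Hs)) |`| Gs |\<union>| (\<lambda>H'. game_add (Game Gs) H') |`| Hs)"

text \<open>Every game is either a \<open>\<P>\<close>-position or an \<open>\<N>\<close>-position, so two games have the same
  outcome iff both or neither of them are \<open>\<P>\<close>-positions.\<close>

fun P_position :: "game \<Rightarrow> bool" where
  "P_position (Game Gs) \<longleftrightarrow> Gs \<noteq> {||} \<and> fBall Gs (\<lambda>G'. \<not> P_position G')"

abbreviation N_position :: "game \<Rightarrow> bool" where
  "N_position G \<equiv> \<not> P_position G"

definition same_outcome :: "game \<Rightarrow> game \<Rightarrow> bool" where
  "same_outcome G H \<longleftrightarrow> P_position G \<and> P_position H \<or> N_position G \<and> N_position H"

definition closed_games :: "game set \<Rightarrow> bool" where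
  "closed_games A \<longleftrightarrow>
     zero_game \<in> A \<and>
     (\<forall>G\<in>A. \<forall>G'. G' |\<in>| options G \<longrightarrow> G' \<in> A) \<and>
     (\<forall>G\<in>A. \<forall>H\<in>A. game_add G H \<in> A)"


section \<open>Bipartite monoids\<close>

record 'a bipartite_monoid = "'a monoid" +
  distinguished :: "'a set"

definition bipartite_monoid :: "'a bipartite_monoid \<Rightarrow> bool" where
  "bipartite_monoid Q \<longleftrightarrow> comm_monoid Q \<and> distinguished Q \<subseteq> carrier Q"

definition bm_isomorphic :: "'a bipartite_monoid \<Rightarrow> 'b bipartite_monoid \<Rightarrow> bool"
  (infix "\<cong>\<^sub>b\<^sub>m" 50) where
  "Q \<cong>\<^sub>b\<^sub>m Q' \<longleftrightarrow> (\<exists>f \<in> iso Q Q'. f ` distinguished Q = distinguished Q')"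

text \<open>The quotient by a relation \<open>r\<close> is meaningful only if \<open>r\<close> is a congruence on \<open>Q\<close>; the union
  in the product is then the class of \<open>x \<otimes> y\<close> for any representatives \<open>x\<close>, \<open>y\<close>.\<close>

definition bm_quotient :: "'a bipartite_monoid \<Rightarrow> 'a rel \<Rightarrow> 'a set bipartite_monoid" where
  "bm_quotient Q r =
     \<lparr>carrier = carrier Q // r,
      mult = (\<lambda>C D. \<Union>x\<in>C. \<Union>y\<in>D. r `` {x \<otimes>\<^bsub>Q\<^esub> y}),
      one = r `` {\<one>\<^bsub>Q\<^esub>},
      distinguished = (\<lambda>x. r `` {x}) ` distinguished Q\<rparr>"

definition indistinguishable :: "'a bipartite_monoid \<Rightarrow> 'a rel" where
  "indistinguishable Q =
     {(x, y). x \<in> carrier Q \<and> y \<in> carrier Q \<and>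
        (\<forall>w \<in> carrier Q. x \<otimes>\<^bsub>Q\<^esub> w \<in> distinguished Q \<longleftrightarrow> y \<otimes>\<^bsub>Q\<^esub> w \<in> distinguished Q)}"

definition reduction :: "'a bipartite_monoid \<Rightarrow> 'a set bipartite_monoid" where
  "reduction Q = bm_quotient Q (indistinguishable Q)"

definition reduced :: "'a bipartite_monoid \<Rightarrow> bool" where
  "reduced Q \<longleftrightarrow> bipartite_monoid Q \<and> indistinguishable Q = Id_on (carrier Q)"

text \<open>The sub-bipartite-monoid of \<open>Q\<close> on a submonoid \<open>S\<close>; its distinguished subset is determined
  by \<open>S\<close>.\<close>

definition sub_bm :: "'a bipartite_monoid \<Rightarrow> 'a set \<Rightarrow> 'a bipartite_monoid" where
  "sub_bm Q S = Q\<lparr>carrier := S, distinguished := distinguished Q \<inter> S\<rparr>"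

definition generated_submonoid :: "'a bipartite_monoid \<Rightarrow> 'a set \<Rightarrow> 'a set" where
  "generated_submonoid Q X = \<Inter>{H. submonoid H Q \<and> X \<subseteq> H}"

text \<open>\<open>one_stage_extension Q Q'\<close> says that \<open>Q'\<close> is a one-stage extension of \<open>Q\<close>.\<close>

definition one_stage_extension :: "'a bipartite_monoid \<Rightarrow> 'b bipartite_monoid \<Rightarrow> bool" where
  "one_stage_extension Q Q' \<longleftrightarrow>
     reduced Q \<and> reduced Q' \<and>
     (\<exists>S. submonoid S Q' \<and> reduction (sub_bm Q' S) \<cong>\<^sub>b\<^sub>m Q \<and>
          (\<exists>x \<in> carrier Q' - S. generated_submonoid Q' (S \<union> {x}) = carrier Q'))"


section \<open>Misere quotients\<close>

definition games_bm :: "game set \<Rightarrow> game bipartite_monoid" where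
  "games_bm A = \<lparr>carrier = A, mult = game_add, one = zero_game,
                 distinguished = {G \<in> A. P_position G}\<rparr>"

definition game_equiv :: "game set \<Rightarrow> game rel" where
  "game_equiv A =
     {(G, H). G \<in> A \<and> H \<in> A \<and> (\<forall>X\<in>A. same_outcome (game_add G X) (game_add H X))}"

definition quotient_of_games :: "game set \<Rightarrow> game set bipartite_monoid" where
  "quotient_of_games A = bm_quotient (games_bm A) (game_equiv A)"

definition misere_quotient :: "'a bipartite_monoid \<Rightarrow> bool" where
  "misere_quotient Q \<longleftrightarrow>
     bipartite_monoid Q \<and> (\<exists>A. closed_games A \<and> Q \<cong>\<^sub>b\<^sub>m quotient_of_games A)"


section \<open>The bipartite monoids \<open>\<T>\<^sub>k\<close> and \<open>\<R>\<^bsub>2^k+4\<^esub>\<close>\<close>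

text \<open>The multiplication does not depend on \<open>k\<close>,
  and that of \<open>\<T>\<^sub>k\<close> is the restriction to the carrier \<open>{1, a, z\<^sub>0, z\<^sub>1, \<dots>}\<close>.\<close>

datatype elt = el_1 | el_a | el_z nat | el_t | el_at

fun elt_mult :: "elt \<Rightarrow> elt \<Rightarrow> elt" where
  "elt_mult el_1 y = y"
| "elt_mult x el_1 = x"
| "elt_mult el_a el_a = el_1"
| "elt_mult el_a (el_z i) = el_z (xor i 1)"
| "elt_mult el_a el_t = el_at"
| "elt_mult el_a el_at = el_t"
| "elt_mult (el_z i) el_a = el_z (xor i 1)"
| "elt_mult (el_z i) (el_z j) = el_z (xor i j)"
| "elt_mult (el_z i) el_t = el_z i"
| "elt_mult (el_z i) el_at = el_z (xor i 1)"
| "elt_mult el_t el_a = el_at"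
| "elt_mult el_t (el_z i) = el_z i"
| "elt_mult el_t el_t = el_z 0"
| "elt_mult el_t el_at = el_z 1"
| "elt_mult el_at el_a = el_t"
| "elt_mult el_at (el_z i) = el_z (xor i 1)"
| "elt_mult el_at el_t = el_z 1"
| "elt_mult el_at el_at = el_z 0"

definition T_bm :: "nat \<Rightarrow> elt bipartite_monoid" where
  "T_bm k = \<lparr>carrier = {el_1, el_a} \<union> el_z ` {..<2 ^ k}, mult = elt_mult, one = el_1,
             distinguished = {el_a, el_z 0}\<rparr>"

text \<open>\<open>R_bm k\<close> is \<open>\<R>\<^bsub>2^k+4\<^esub>\<close>: the index here is \<open>k\<close>, not the order \<open>2^k+4\<close>.\<close>

definition R_bm :: "nat \<Rightarrow> elt bipartite_monoid" where
  "R_bm k = \<lparr>carrier = carrier (T_bm k) \<union> {el_t, el_at}, mult = elt_mult, one = el_1,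
             distinguished = {el_a, el_z 0}\<rparr>"

end

theory Submission
  imports Defs
begin

text \<open>
  Let \<open>\<P> = {a, b}\<close> with \<open>a\<close> the class of \<open>*\<close>, so \<open>a\<^sup>2 = 1\<close>. A minimal game \<open>C\<close> whose class is
  neither \<open>1\<close> nor \<open>a\<close> behaves like \<open>*2\<close>; hence all positive even multiples of \<open>C\<close> are
  \<open>\<P>\<close>-positions, which forces \<open>b\<close> to be the class of \<open>C + C\<close> and to be idempotent. Comparing
  the sums \<open>X + X + C + C\<close> and \<open>X + X\<close> for a minimal counterexample \<open>X\<close> gives \<open>x\<^sup>2 b = b\<close> for
  every \<open>x\<close>, so \<open>b\<Q>\<close> is a group of exponent two. The winning moves in \<open>G + G\<close> and \<open>G + H\<close> then
  show that \<open>1\<close> and \<open>a\<close> are the only units and that \<open>u v = b\<close> for non-units with \<open>u b = v b\<close>. As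
  \<open>\<Q>\<close> is reduced, every \<open>u\<close> outside \<open>{1, a}\<close> either lies in the group \<open>b\<Q>\<close> or satisfies
  \<open>u b \<in> {b, ab}\<close>. The submonoid \<open>\<S>\<close> reducing to \<open>\<T>\<^sub>n\<close> is \<open>{1, a}\<close> together with a
  subgroup of \<open>b\<Q>\<close>; adjoining \<open>x\<close> either doubles that subgroup or adds a pair
  \<open>{t, at}\<close> with \<open>t b = b\<close>.
\<close>

section \<open>Sums of games\<close>

text \<open>Numbers below \<open>2 ^ k\<close> are the fixed points of \<open>take_bit k\<close>,
  which commutes with \<open>xor\<close>.\<close>

lemma xor_less: "i < 2 ^ k \<Longrightarrow> j < 2 ^ k \<Longrightarrow> xor i j < (2::nat) ^ k"
  by (metis take_bit_nat_eq_self_iff take_bit_xor)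

lemma size_option: "G' |\<in>| options G \<Longrightarrow> size G' < size G"
  using size_option_less by (cases G) simp

lemma options_game_add:
  "options (game_add G H) =
     (\<lambda>G'. game_add G' H) |`| options G |\<union>| game_add G |`| options H"
  by (cases G; cases H) simp

lemma option_game_add_iff:
  "K |\<in>| options (game_add G H) \<longleftrightarrow>
     (\<exists>G'. G' |\<in>| options G \<and> K = game_add G' H) \<or>
     (\<exists>H'. H' |\<in>| options H \<and> K = game_add G H')"
  by (auto simp: options_game_add)

lemma P_position_iff:
  "P_position G \<longleftrightarrow>
     options G \<noteq> {||} \<and> (\<forall>G'. G' |\<in>| options G \<longrightarrow> \<not> P_position G')"
  by (cases G) auto

lemma options_eq_empty_iff: "options G = {||} \<longleftrightarrow> G = zero_game"
  by (cases G) (simp add: zero_game_def)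

lemma game_eqI: "(\<And>K. K |\<in>| options G \<longleftrightarrow> K |\<in>| options H) \<Longrightarrow> G = H"
  by (rule game.expand) blast

lemma game_add_zero: "game_add G zero_game = G"
proof (induction "size G" arbitrary: G rule: less_induct)
  case less
  show ?case
  proof (rule game_eqI)
    fix K
    have "G' |\<in>| options G \<Longrightarrow> game_add G' zero_game = G'" for G'
      using less size_option by blast
    then show "K |\<in>| options (game_add G zero_game) \<longleftrightarrow> K |\<in>| options G"
      by (auto simp: option_game_add_iff) (simp_all add: zero_game_def)
  qed
qed

lemma game_add_commute: "game_add G H = game_add H G"
proof (induction "size G + size H" arbitrary: G H rule: less_induct)
  case less
  have "G' |\<in>| options G \<Longrightarrow> game_add G' H = game_add H G'" for G'
    using less[of G' H] size_option by simp
  moreover have "H' |\<in>| options H \<Longrightarrow> game_add G H' = game_add H' G" for H'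
    using less[of G H'] size_option by simp
  ultimately show ?case
    by (intro game_eqI) (auto simp: option_game_add_iff)
qed

lemma game_add_assoc: "game_add (game_add G H) K = game_add G (game_add H K)"
proof (induction "size G + size H + size K" arbitrary: G H K rule: less_induct)
  case less
  have "G' |\<in>| options G \<Longrightarrow>
      game_add (game_add G' H) K = game_add G' (game_add H K)" for G'
    using less[of G' H K] size_option by simp
  moreover have "H' |\<in>| options H \<Longrightarrow>
      game_add (game_add G H') K = game_add G (game_add H' K)" for H'
    using less[of G H' K] size_option by simp
  moreover have "K' |\<in>| options K \<Longrightarrow>
      game_add (game_add G H) K' = game_add G (game_add H K')" for K'
    using less[of G H K'] size_option by simp
  ultimately show ?case
    by (intro game_eqI) (auto simp: option_game_add_iff)
qed

lemma comm_monoid_games_bm: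
  assumes "closed_games A"
  shows "comm_monoid (games_bm A)"
proof (rule comm_monoidI)
  show "G \<otimes>\<^bsub>games_bm A\<^esub> H = H \<otimes>\<^bsub>games_bm A\<^esub> G" for G H
    by (simp add: games_bm_def game_add_commute)
  show "\<one>\<^bsub>games_bm A\<^esub> \<otimes>\<^bsub>games_bm A\<^esub> G = G" for G
    using game_add_commute[of zero_game G] by (simp add: games_bm_def game_add_zero)
qed (use assms in \<open>simp_all add: games_bm_def closed_games_def game_add_assoc\<close>)

section \<open>Epimorphisms of bipartite monoids\<close>

text \<open>Quotient maps, isomorphisms and their composites all take this form. Membership in the
  distinguished subset is reflected as well as preserved, so outcomes can be read off on either
  side.\<close>

definition bm_epi :: "('a \<Rightarrow> 'b) \<Rightarrow> 'a bipartite_monoid \<Rightarrow> 'b bipartite_monoid \<Rightarrow> bool" where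
  "bm_epi h M N \<longleftrightarrow>
     h ` carrier M = carrier N \<and> h \<one>\<^bsub>M\<^esub> = \<one>\<^bsub>N\<^esub> \<and>
     (\<forall>x\<in>carrier M. \<forall>y\<in>carrier M. h (x \<otimes>\<^bsub>M\<^esub> y) = h x \<otimes>\<^bsub>N\<^esub> h y) \<and>
     (\<forall>x\<in>carrier M. h x \<in> distinguished N \<longleftrightarrow> x \<in> distinguished M)"

lemma bm_epi_comp: "bm_epi h M N \<Longrightarrow> bm_epi g N L \<Longrightarrow> bm_epi (\<lambda>x. g (h x)) M L"
proof -
  assume h: "bm_epi h M N" and g: "bm_epi g N L"
  have "h x \<in> carrier N" if "x \<in> carrier M" for x
    using h that unfolding bm_epi_def by blast
  moreover have "(\<lambda>x. g (h x)) ` carrier M = carrier L"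
    using h g unfolding bm_epi_def by (metis image_image)
  ultimately show ?thesis using h g unfolding bm_epi_def by simp
qed

text \<open>Commutativity turns the one-sided condition \<open>cong\<close> into compatibility in
  both arguments, so the union in the product of two classes is a single class. By
  \<open>dist\<close>, the distinguished subset is a union of classes, hence determined by its
  image.\<close>

lemma bm_epi_quotient:
  assumes M: "comm_monoid M" and D: "distinguished M \<subseteq> carrier M"
    and r: "equiv (carrier M) r"
    and cong: "\<And>x y z. (x, y) \<in> r \<Longrightarrow> z \<in> carrier M \<Longrightarrow>
       (x \<otimes>\<^bsub>M\<^esub> z, y \<otimes>\<^bsub>M\<^esub> z) \<in> r"
    and dist: "\<And>x y. (x, y) \<in> r \<Longrightarrow> x \<in> distinguished M \<Longrightarrow> y \<in> distinguished M"
  shows "bm_epi (\<lambda>x. r `` {x}) M (bm_quotient M r)"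
proof -
  interpret comm_monoid M by fact
  have sub: "x \<in> carrier M \<and> y \<in> carrier M" if "(x, y) \<in> r" for x y
    using equiv_type[OF r] that by auto
  have mult: "(\<Union>x'\<in>r `` {x}. \<Union>y'\<in>r `` {y}. r `` {x' \<otimes>\<^bsub>M\<^esub> y'}) = r `` {x \<otimes>\<^bsub>M\<^esub> y}"
    if x: "x \<in> carrier M" and y: "y \<in> carrier M" for x y
  proof -
    have "r `` {x' \<otimes>\<^bsub>M\<^esub> y'} = r `` {x \<otimes>\<^bsub>M\<^esub> y}"
      if "(x, x') \<in> r" "(y, y') \<in> r" for x' y'
    proof -
      have "(x \<otimes>\<^bsub>M\<^esub> y, x' \<otimes>\<^bsub>M\<^esub> y) \<in> r" using cong that y by blast
      moreover have "(x' \<otimes>\<^bsub>M\<^esub> y, x' \<otimes>\<^bsub>M\<^esub> y') \<in> r"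
        using cong[of y y' x'] that sub by (simp add: m_comm)
      ultimately have "(x \<otimes>\<^bsub>M\<^esub> y, x' \<otimes>\<^bsub>M\<^esub> y') \<in> r"
        using r by (meson equivE transD)
      then show ?thesis using equiv_class_eq[OF r] by simp
    qed
    moreover have "(x, x) \<in> r" "(y, y) \<in> r"
      using r x y by (auto simp: equiv_def refl_on_def)
    ultimately show ?thesis by blast
  qed
  have "r `` {x} \<in> (\<lambda>x. r `` {x}) ` distinguished M \<longleftrightarrow> x \<in> distinguished M"
    if "x \<in> carrier M" for x
    using that D dist eq_equiv_class[OF _ r] by (auto simp: image_iff) (metis in_mono)
  then show ?thesis
    unfolding bm_epi_def bm_quotient_def by (auto simp: mult quotient_def)
qed

text \<open>Membership in \<open>hom\<close> concerns products only, so preservation of the unit has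
  to be derived. \<open>N\<close> comes without monoid laws; its unit law is carried over from
  \<open>M\<close> along \<open>h\<close>.\<close>

lemma bm_epi_iso:
  assumes epi: "bm_epi h M N" and M: "comm_monoid M" and iso: "f \<in> iso N L"
    and L: "comm_monoid L" and N: "distinguished N \<subseteq> carrier N"
    and dist: "f ` distinguished N = distinguished L"
  shows "bm_epi f N L"
proof -
  interpret M: comm_monoid M by fact
  interpret L: comm_monoid L by fact
  have bij: "bij_betw f (carrier N) (carrier L)" and hom: "f \<in> hom N L"
    using iso by (auto simp: iso_def)
  have h: "h ` carrier M = carrier N" "h \<one>\<^bsub>M\<^esub> = \<one>\<^bsub>N\<^esub>"
    "\<And>x y. x \<in> carrier M \<Longrightarrow> y \<in> carrier M \<Longrightarrow>
       h (x \<otimes>\<^bsub>M\<^esub> y) = h x \<otimes>\<^bsub>N\<^esub> h y"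
    using epi by (auto simp: bm_epi_def)
  have N1: "\<one>\<^bsub>N\<^esub> \<in> carrier N"
    using imageI[OF M.one_closed, of h] h(1,2) by simp
  obtain x where x: "x \<in> carrier N" "f x = \<one>\<^bsub>L\<^esub>"
    using bij_betw_imp_surj_on[OF bij] L.one_closed by (metis imageE)
  obtain x' where x': "x' \<in> carrier M" "x = h x'" using h(1) x(1) by blast
  have "\<one>\<^bsub>N\<^esub> \<otimes>\<^bsub>N\<^esub> x = x"
    using h(2) h(3)[OF M.one_closed x'(1)] M.l_one[OF x'(1)] x'(2) by metis
  then have "f \<one>\<^bsub>N\<^esub> \<otimes>\<^bsub>L\<^esub> \<one>\<^bsub>L\<^esub> = \<one>\<^bsub>L\<^esub>"
    using hom_mult[OF hom N1 x(1)] x(2) by metis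
  then have f1: "f \<one>\<^bsub>N\<^esub> = \<one>\<^bsub>L\<^esub>"
    using L.r_one[OF hom_in_carrier[OF hom N1]] by metis
  have "f x \<in> distinguished L \<longleftrightarrow> x \<in> distinguished N" if "x \<in> carrier N" for x
    using inj_on_image_mem_iff[OF bij_betw_imp_inj_on[OF bij] that N] dist by simp
  then show ?thesis
    using bij_betw_imp_surj_on[OF bij] hom f1 by (simp add: bm_epi_def hom_mult)
qed

lemma iso_inv_into:
  assumes iso: "f \<in> iso L N"
    and closed: "\<And>x y. x \<in> carrier L \<Longrightarrow> y \<in> carrier L \<Longrightarrow> x \<otimes>\<^bsub>L\<^esub> y \<in> carrier L"
  shows "inv_into (carrier L) f \<in> iso N L"
proof -
  let ?g = "inv_into (carrier L) f"
  have hom: "f \<in> hom L N" and bij: "bij_betw f (carrier L) (carrier N)"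
    using iso by (auto simp: iso_def)
  note inj = bij_betw_imp_inj_on[OF bij] and surj = bij_betw_imp_surj_on[OF bij]
  have "?g (x \<otimes>\<^bsub>N\<^esub> y) = ?g x \<otimes>\<^bsub>L\<^esub> ?g y"
    if xy: "x \<in> carrier N" "y \<in> carrier N" for x y
  proof -
    obtain x' y' where "x' \<in> carrier L" "x = f x'" "y' \<in> carrier L" "y = f y'"
      using xy surj by blast
    then show ?thesis
      using inv_into_f_f[OF inj] closed by (simp flip: hom_mult[OF hom])
  qed
  moreover have "?g ` carrier N = carrier L"
    using bij_betw_imp_surj_on[OF bij_betw_inv_into[OF bij]] .
  ultimately show ?thesis
    using bij_betw_inv_into[OF bij] by (auto simp: iso_def hom_def)
qed

text \<open>A map out of an explicit multiplication table is easily given by cases; its inverse is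
  the isomorphism in the required direction.\<close>

lemma bm_isomorphicI:
  assumes iso: "f \<in> iso L N"
    and closed: "\<And>x y. x \<in> carrier L \<Longrightarrow> y \<in> carrier L \<Longrightarrow> x \<otimes>\<^bsub>L\<^esub> y \<in> carrier L"
    and D: "distinguished L \<subseteq> carrier L" and dist: "f ` distinguished L = distinguished N"
  shows "N \<cong>\<^sub>b\<^sub>m L"
proof -
  have "inj_on f (carrier L)" using iso by (auto simp: iso_def bij_betw_def)
  then have "inv_into (carrier L) f ` distinguished N = distinguished L"
    unfolding dist[symmetric] using D by (rule inv_into_image_cancel)
  then show ?thesis
    unfolding bm_isomorphic_def using iso_inv_into[OF iso closed] by blast
qed

lemma bm_epi_iso_inv:
  assumes epi: "bm_epi h M N" and iso: "f \<in> iso L N"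
    and M: "comm_monoid M" and L: "comm_monoid L" and D: "distinguished L \<subseteq> carrier L"
    and dist: "f ` distinguished L = distinguished N"
  shows "bm_epi (inv_into (carrier L) f) N L"
proof -
  interpret L: comm_monoid L by fact
  have "inj_on f (carrier L)" and surj: "f ` carrier L = carrier N"
    using iso by (auto simp: iso_def bij_betw_def)
  then have "inv_into (carrier L) f ` distinguished N = distinguished L"
    unfolding dist[symmetric] using D by (intro inv_into_image_cancel)
  moreover have "distinguished N \<subseteq> carrier N"
    using D surj dist by blast
  ultimately show ?thesis
    using bm_epi_iso[OF epi M iso_inv_into[OF iso] L] L.m_closed by blast
qed

text \<open>Composing the quotient map on games with the inverse of the given isomorphism represents
  every element of \<open>Q\<close> by a game. Closure of \<open>A\<close> under sums makes
  \<open>game_equiv A\<close> a congruence.\<close>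

lemma misere_quotient_epi:
  assumes "misere_quotient Q"
  obtains A h where "closed_games A" "bm_epi h (games_bm A) Q"
proof -
  obtain A f where A: "closed_games A" and f: "f \<in> iso Q (quotient_of_games A)"
    "f ` distinguished Q = distinguished (quotient_of_games A)"
    and Q: "comm_monoid Q" "distinguished Q \<subseteq> carrier Q"
    using assms by (auto simp: misere_quotient_def bm_isomorphic_def bipartite_monoid_def)
  have clo: "G \<in> A \<Longrightarrow> H \<in> A \<Longrightarrow> game_add G H \<in> A" "zero_game \<in> A" for G H
    using A by (auto simp: closed_games_def)
  have "bm_epi (\<lambda>G. game_equiv A `` {G}) (games_bm A) (quotient_of_games A)"
    unfolding quotient_of_games_def
  proof (rule bm_epi_quotient)
    show "comm_monoid (games_bm A)" using A by (rule comm_monoid_games_bm)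
    show "distinguished (games_bm A) \<subseteq> carrier (games_bm A)" by (auto simp: games_bm_def)
    show "equiv (carrier (games_bm A)) (game_equiv A)"
      by (rule equivI)
        (auto simp: refl_on_def sym_def trans_def games_bm_def game_equiv_def same_outcome_def)
    show "(G \<otimes>\<^bsub>games_bm A\<^esub> K, H \<otimes>\<^bsub>games_bm A\<^esub> K) \<in> game_equiv A"
      if "(G, H) \<in> game_equiv A" "K \<in> carrier (games_bm A)" for G H K
      using that clo by (auto simp: game_equiv_def games_bm_def game_add_assoc)
    show "H \<in> distinguished (games_bm A)"
      if "(G, H) \<in> game_equiv A" "G \<in> distinguished (games_bm A)" for G H
    proof -
      \<comment> \<open>Testing with the zero game shows that equivalent games have the same
        outcome.\<close>
      have "same_outcome (game_add G zero_game) (game_add H zero_game)"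
        using that clo by (auto simp: game_equiv_def)
      then show ?thesis
        using that by (auto simp: game_equiv_def games_bm_def same_outcome_def game_add_zero)
    qed
  qed
  from bm_epi_comp[OF this bm_epi_iso_inv[OF this f(1) comm_monoid_games_bm[OF A] Q f(2)]]
  show ?thesis using that A by blast
qed

text \<open>Indistinguishability is a congruence by associativity, and testing with the unit shows
  that it respects the distinguished subset.\<close>

lemma reduction_epi:
  assumes M: "comm_monoid M" and D: "distinguished M \<subseteq> carrier M"
    and L: "comm_monoid L" and iso: "reduction M \<cong>\<^sub>b\<^sub>m L"
  obtains h where "bm_epi h M L"
proof -
  interpret comm_monoid M by fact
  have epi: "bm_epi (\<lambda>x. indistinguishable M `` {x}) M (reduction M)"
    unfolding reduction_def
  proof (rule bm_epi_quotient[OF M D])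
    show "equiv (carrier M) (indistinguishable M)"
      by (rule equivI) (auto simp: refl_on_def sym_def trans_def indistinguishable_def)
    show "(x \<otimes>\<^bsub>M\<^esub> z, y \<otimes>\<^bsub>M\<^esub> z) \<in> indistinguishable M"
      if "(x, y) \<in> indistinguishable M" "z \<in> carrier M" for x y z
      using that by (auto simp: indistinguishable_def m_assoc)
    show "y \<in> distinguished M"
      if xy: "(x, y) \<in> indistinguishable M" "x \<in> distinguished M" for x y
    proof -
      have "x \<otimes>\<^bsub>M\<^esub> \<one>\<^bsub>M\<^esub> \<in> distinguished M \<longleftrightarrow>
          y \<otimes>\<^bsub>M\<^esub> \<one>\<^bsub>M\<^esub> \<in> distinguished M"
        and "x \<in> carrier M" "y \<in> carrier M"
        using xy one_closed unfolding indistinguishable_def by blast+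
      then show ?thesis using xy(2) by simp
    qed
  qed
  obtain f where f: "f \<in> iso (reduction M) L"
    "f ` distinguished (reduction M) = distinguished L"
    using iso by (auto simp: bm_isomorphic_def)
  have "distinguished (reduction M) \<subseteq> carrier (reduction M)"
    using D by (auto simp: reduction_def bm_quotient_def quotient_def)
  from bm_epi_comp[OF epi bm_epi_iso[OF epi M f(1) L this f(2)]] show ?thesis by (rule that)
qed

section \<open>Misere quotients with two P-classes\<close>

text \<open>\<open>cls\<close> sends a game to its class in \<open>Q\<close>, so that statements
  about elements of \<open>Q\<close> can be proved by induction on the size of a representing
  game.\<close>

locale two_P_quotient = comm_monoid Q for Q :: "'a bipartite_monoid" (structure) +
  fixes A :: "game set" and cls :: "game \<Rightarrow> 'a"
  assumes closed: "closed_games A"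
    and epi: "bm_epi cls (games_bm A) Q"
    and reduced: "reduced Q"
    and card_P: "card (distinguished Q) = 2"
begin

abbreviation P :: "'a set" where "P \<equiv> distinguished Q"

definition star :: game where "star = Game {|zero_game|}"

definition a :: 'a where "a = cls star"

definition b :: 'a where "b = (THE x. x \<in> P \<and> x \<noteq> a)"

section \<open>Outcomes of sums in terms of classes\<close>

lemma
  shows zero_in: "zero_game \<in> A"
    and option_in: "G \<in> A \<Longrightarrow> G' |\<in>| options G \<Longrightarrow> G' \<in> A"
    and add_in: "G \<in> A \<Longrightarrow> H \<in> A \<Longrightarrow> game_add G H \<in> A"
  using closed by (auto simp: closed_games_def)

lemma
  shows cls_closed [simp, intro]: "G \<in> A \<Longrightarrow> cls G \<in> carrier Q"
    and cls_zero: "cls zero_game = \<one>"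
    and cls_add: "G \<in> A \<Longrightarrow> H \<in> A \<Longrightarrow> cls (game_add G H) = cls G \<otimes> cls H"
    and cls_P: "G \<in> A \<Longrightarrow> cls G \<in> P \<longleftrightarrow> P_position G"
proof -
  have epi': "cls ` A = carrier Q" "cls zero_game = \<one>"
    "\<forall>G\<in>A. \<forall>H\<in>A. cls (game_add G H) = cls G \<otimes> cls H"
    "\<forall>G\<in>A. cls G \<in> P \<longleftrightarrow> G \<in> A \<and> P_position G"
    using epi by (simp_all add: bm_epi_def games_bm_def)
  show "G \<in> A \<Longrightarrow> cls G \<in> carrier Q" using epi'(1) by (metis imageI)
  show "cls zero_game = \<one>" by (rule epi')
  show "G \<in> A \<Longrightarrow> H \<in> A \<Longrightarrow> cls (game_add G H) = cls G \<otimes> cls H"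
    using epi'(3) by blast
  show "G \<in> A \<Longrightarrow> cls G \<in> P \<longleftrightarrow> P_position G" using epi'(4) by blast
qed

lemma cls_surj:
  assumes "u \<in> carrier Q"
  obtains G where "G \<in> A" "cls G = u"
proof -
  have "u \<in> cls ` A" using epi assms by (simp add: bm_epi_def games_bm_def)
  then show ?thesis using that by blast
qed

lemma P_subset: "P \<subseteq> carrier Q"
  using reduced by (simp add: reduced_def bipartite_monoid_def)

lemma reducedD:
  assumes "u \<in> carrier Q" "v \<in> carrier Q"
    and "\<And>w. w \<in> carrier Q \<Longrightarrow> u \<otimes> w \<in> P \<longleftrightarrow> v \<otimes> w \<in> P"
  shows "u = v"
proof -
  have "(u, v) \<in> indistinguishable Q" using assms by (auto simp: indistinguishable_def)
  then show ?thesis using reduced by (auto simp: reduced_def)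
qed

text \<open>As \<open>Q\<close> is reduced and \<open>cls\<close> is onto, tests against classes of
  games suffice; this opens the way to induction on the test game \<open>W\<close>.\<close>

lemma cls_eqI:
  assumes "G \<in> A" "u \<in> carrier Q"
    and "\<And>W. W \<in> A \<Longrightarrow> cls G \<otimes> cls W \<in> P \<longleftrightarrow> u \<otimes> cls W \<in> P"
  shows "cls G = u"
proof (rule reducedD)
  fix w assume "w \<in> carrier Q"
  then show "cls G \<otimes> w \<in> P \<longleftrightarrow> u \<otimes> w \<in> P"
    using assms(3) cls_surj by metis
qed (use assms in auto)

text \<open>The recursion for outcomes at the sum of \<open>G\<close> and \<open>H\<close>, read
  through \<open>cls\<close>. Misere play enters in the first conjunct, which excludes the empty
  sum.\<close>

lemma outcome_iff:
  assumes "G \<in> A" "H \<in> A"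
  shows "cls G \<otimes> cls H \<in> P \<longleftrightarrow> (G \<noteq> zero_game \<or> H \<noteq> zero_game) \<and>
    (\<forall>G'. G' |\<in>| options G \<longrightarrow> cls G' \<otimes> cls H \<notin> P) \<and>
    (\<forall>H'. H' |\<in>| options H \<longrightarrow> cls G \<otimes> cls H' \<notin> P)"
proof -
  have "cls G \<otimes> cls H \<in> P \<longleftrightarrow> P_position (game_add G H)"
    using assms by (simp add: cls_P add_in flip: cls_add)
  also have "\<dots> \<longleftrightarrow> options (game_add G H) \<noteq> {||} \<and>
    (\<forall>K. K |\<in>| options (game_add G H) \<longrightarrow> cls K \<notin> P)"
    using assms by (subst P_position_iff) (metis option_in add_in cls_P)
  also have "options (game_add G H) = {||} \<longleftrightarrow> G = zero_game \<and> H = zero_game"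
    by (simp add: options_game_add options_eq_empty_iff)
  also have "(\<forall>K. K |\<in>| options (game_add G H) \<longrightarrow> cls K \<notin> P) \<longleftrightarrow>
    (\<forall>G'. G' |\<in>| options G \<longrightarrow> cls G' \<otimes> cls H \<notin> P) \<and>
    (\<forall>H'. H' |\<in>| options H \<longrightarrow> cls G \<otimes> cls H' \<notin> P)"
    unfolding option_game_add_iff using assms by (metis cls_add option_in)
  finally show ?thesis by blast
qed

lemma option_P:
  assumes "G \<in> A" "G' |\<in>| options G" "w \<in> carrier Q" "cls G' \<otimes> w \<in> P"
  shows "cls G \<otimes> w \<notin> P"
  using assms outcome_iff by (metis cls_surj)

lemma one_notin_P: "\<one> \<notin> P"
  using cls_P[OF zero_in] cls_zero by (simp add: zero_game_def)

lemma zero_no_option: "K |\<notin>| options zero_game"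
  by (simp add: zero_game_def)

section \<open>The classes of \<open>*\<close> and \<open>* + *\<close>, and a game like
  \<open>*2\<close>\<close>

lemma option_star_iff: "K |\<in>| options star \<longleftrightarrow> K = zero_game"
  by (simp add: star_def)

lemma star_ne_zero: "star \<noteq> zero_game"
  using option_star_iff zero_no_option by metis

text \<open>Descending through non-zero options of a non-zero game in \<open>A\<close> ends at a
  game whose only option is zero, which is \<open>star\<close>. A non-zero game exists because
  \<open>P\<close> is non-empty and does not contain the class of zero.\<close>

lemma star_in: "star \<in> A"
proof -
  have *: "G \<in> A \<Longrightarrow> G \<noteq> zero_game \<Longrightarrow> star \<in> A" for G
  proof (induction "size G" arbitrary: G rule: less_induct)
    case less
    show ?case
    proof (cases "\<exists>G'. G' |\<in>| options G \<and> G' \<noteq> zero_game")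
      case True
      then show ?thesis using less option_in size_option by blast
    next
      case False
      moreover have "options G \<noteq> {||}" using less by (simp add: options_eq_empty_iff)
      ultimately have "G = star" by (intro game_eqI) (auto simp: option_star_iff)
      then show ?thesis using less by simp
    qed
  qed
  obtain u where "u \<in> P" using card_P by fastforce
  then obtain G where "G \<in> A" "cls G \<in> P" using P_subset cls_surj by blast
  then show ?thesis using * cls_zero one_notin_P by metis
qed

lemma a_closed [simp, intro]: "a \<in> carrier Q"
  using star_in by (simp add: a_def)

lemma a_P: "a \<in> P"
proof -
  have "P_position star" by (simp add: star_def zero_game_def)
  then show ?thesis using cls_P[OF star_in] by (simp add: a_def)
qed

lemma star_move:
  assumes "w \<in> carrier Q" "w \<in> P"
  shows "a \<otimes> w \<notin> P"
  unfolding a_def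
  using option_P[OF star_in, of zero_game w] assms by (simp add: option_star_iff cls_zero)

lemma b_facts: "P = {a, b}" "b \<noteq> a"
proof -
  obtain x y where "P = {x, y}" "x \<noteq> y" using card_P by (meson card_2_iff)
  then obtain z where z: "P = {a, z}" "z \<noteq> a" using a_P by auto
  then have "b = z" unfolding b_def by (intro the_equality) auto
  then show "P = {a, b}" "b \<noteq> a" using z by simp_all
qed

lemma b_closed [simp, intro]: "b \<in> carrier Q"
  using b_facts(1) P_subset by blast

lemma b_P: "b \<in> P" using b_facts by simp

lemma b_ne_one: "b \<noteq> \<one>" and a_ne_one: "a \<noteq> \<one>"
  using b_P a_P one_notin_P by metis+

text \<open>Every option of \<open>* + *\<close> has class \<open>a\<close>. Beside a P-position
  this gives no winning move, by \<open>star_move\<close>; beside a non-zero N-position a winning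
  move in \<open>W\<close> still wins, by induction; beside zero it wins because \<open>*\<close> is
  a P-position. So \<open>* + *\<close> is indistinguishable from zero.\<close>

lemma a_sq: "a \<otimes> a = \<one>"
proof -
  have "a \<otimes> a \<otimes> cls W \<in> P \<longleftrightarrow> cls W \<in> P" if "W \<in> A" for W
    using that
  proof (induction "size W" arbitrary: W rule: less_induct)
    case (less W)
    have IH: "a \<otimes> a \<otimes> cls W' \<in> P \<longleftrightarrow> cls W' \<in> P" if "W' |\<in>| options W" for W'
      using that less option_in size_option by blast
    have eq: "cls (game_add star star) = a \<otimes> a"
      using star_in by (simp add: cls_add a_def)
    have opt: "K |\<in>| options (game_add star star) \<Longrightarrow> cls K = a" for K
      using star_in zero_in
      by (auto simp: option_game_add_iff option_star_iff cls_add cls_zero a_def[symmetric])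
    have nz: "game_add star star \<noteq> zero_game"
      by (metis option_star_iff options_eq_empty_iff option_game_add_iff zero_no_option)
    have ex: "\<exists>K. K |\<in>| options (game_add star star)"
      by (metis option_star_iff option_game_add_iff)
    have W: "cls W \<in> P \<longleftrightarrow> W \<noteq> zero_game \<and> (\<forall>W'. W' |\<in>| options W \<longrightarrow> cls W' \<notin> P)"
      using outcome_iff[OF zero_in less(2)] less(2) option_in
      by (auto simp: cls_zero zero_no_option)
    have "a \<otimes> a \<otimes> cls W \<in> P \<longleftrightarrow>
        a \<otimes> cls W \<notin> P \<and> (\<forall>W'. W' |\<in>| options W \<longrightarrow> cls W' \<notin> P)"
      using outcome_iff[of "game_add star star" W] star_in add_in less(2) IH opt nz ex
      unfolding eq by metis
    also have "\<dots> \<longleftrightarrow> cls W \<in> P"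
    proof (cases "W = zero_game")
      case True
      then show ?thesis using a_P one_notin_P by (simp add: cls_zero)
    next
      case False
      then show ?thesis using W star_move less(2) by blast
    qed
    finally show ?case .
  qed
  then show ?thesis
    using cls_eqI[of "game_add star star" \<one>] star_in by (simp add: add_in cls_add a_def)
qed

lemma a_a [simp]: "u \<in> carrier Q \<Longrightarrow> a \<otimes> (a \<otimes> u) = u"
  using m_assoc[of a a u] by (simp add: a_sq)

text \<open>Such a game has the option classes of \<open>star\<close>, and induction on the test
  game \<open>W\<close> shows that these fix the outcome of every sum.\<close>

lemma cls_eq_a:
  assumes G: "G \<in> A" "G \<noteq> zero_game" and "\<And>G'. G' |\<in>| options G \<Longrightarrow> cls G' = \<one>"
  shows "cls G = a"
proof (rule cls_eqI)
  show "cls G \<otimes> cls W \<in> P \<longleftrightarrow> a \<otimes> cls W \<in> P" if "W \<in> A" for W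
    using that
  proof (induction "size W" arbitrary: W rule: less_induct)
    case (less W)
    have IH: "cls G \<otimes> cls W' \<in> P \<longleftrightarrow> a \<otimes> cls W' \<in> P" if "W' |\<in>| options W" for W'
      using that less option_in size_option by blast
    have "\<exists>G'. G' |\<in>| options G" using G(2) options_eq_empty_iff by blast
    then have "cls G \<otimes> cls W \<in> P \<longleftrightarrow>
        cls W \<notin> P \<and> (\<forall>W'. W' |\<in>| options W \<longrightarrow> a \<otimes> cls W' \<notin> P)"
      using outcome_iff[OF G(1) less(2)] IH assms(3) G(2) less(2) by auto
    also have "\<dots> \<longleftrightarrow> a \<otimes> cls W \<in> P"
      using outcome_iff[OF star_in less(2)] less(2) star_ne_zero
      by (auto simp: option_star_iff cls_zero a_def)
    finally show ?case .
  qed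
qed (use G in auto)

text \<open>The option classes are those of \<open>* + *\<close>, and the induction is the one of
  \<open>a_sq\<close>.\<close>

lemma cls_eq_one:
  assumes G: "G \<in> A" "G \<noteq> zero_game" and "\<And>G'. G' |\<in>| options G \<Longrightarrow> cls G' = a"
  shows "cls G = \<one>"
proof (rule cls_eqI)
  show "cls G \<otimes> cls W \<in> P \<longleftrightarrow> \<one> \<otimes> cls W \<in> P" if "W \<in> A" for W
    using that
  proof (induction "size W" arbitrary: W rule: less_induct)
    case (less W)
    have IH: "cls G \<otimes> cls W' \<in> P \<longleftrightarrow> \<one> \<otimes> cls W' \<in> P" if "W' |\<in>| options W" for W'
      using that less option_in size_option by blast
    have "\<exists>G'. G' |\<in>| options G" using G(2) options_eq_empty_iff by blast
    then have "cls G \<otimes> cls W \<in> P \<longleftrightarrow>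
        a \<otimes> cls W \<notin> P \<and> (\<forall>W'. W' |\<in>| options W \<longrightarrow> \<one> \<otimes> cls W' \<notin> P)"
      using outcome_iff[OF G(1) less(2)] IH assms(3) G(2) less(2) by auto
    also have "\<dots> \<longleftrightarrow> \<one> \<otimes> cls W \<in> P"
    proof (cases "W = zero_game")
      case True
      then show ?thesis using a_P one_notin_P by (simp add: cls_zero)
    next
      case False
      then show ?thesis
        using outcome_iff[OF zero_in less(2)] less(2) star_move[of "cls W"]
        by (auto simp: cls_zero zero_no_option)
    qed
    finally show ?case .
  qed
qed (use G in auto)

text \<open>Take a minimal game whose class is neither the unit nor \<open>a\<close>; the class
  \<open>b\<close> shows that one exists. By minimality its options have these two classes, and both
  occur, since otherwise \<open>cls_eq_a\<close>, \<open>cls_eq_one\<close> or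
  \<open>cls_zero\<close> would apply. These are the option classes of \<open>*2\<close>.\<close>

lemma ex_star2:
  obtains C C0 C1 where "C \<in> A" "C0 |\<in>| options C" "cls C0 = \<one>"
    "C1 |\<in>| options C" "cls C1 = a"
    "\<And>C'. C' |\<in>| options C \<Longrightarrow> cls C' = \<one> \<or> cls C' = a"
proof -
  have *: "\<exists>C C0 C1. C \<in> A \<and> C0 |\<in>| options C \<and> cls C0 = \<one> \<and>
      C1 |\<in>| options C \<and> cls C1 = a \<and>
      (\<forall>C'. C' |\<in>| options C \<longrightarrow> cls C' = \<one> \<or> cls C' = a)"
    if "G \<in> A" "cls G \<noteq> \<one>" "cls G \<noteq> a" for G
    using that
  proof (induction "size G" arbitrary: G rule: less_induct)
    case (less G)
    show ?case
    proof (cases "\<forall>G'. G' |\<in>| options G \<longrightarrow> cls G' = \<one> \<or> cls G' = a")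
      case True
      then show ?thesis using cls_eq_a cls_eq_one less(2-4) cls_zero by metis
    next
      case False
      then show ?thesis using less option_in size_option by blast
    qed
  qed
  obtain G where "G \<in> A" "cls G = b" using b_closed cls_surj by blast
  then show ?thesis using * that b_facts(2) b_ne_one by metis
qed

section \<open>Multiples of a game like \<open>*2\<close> and the idempotence of
  \<open>b\<close>\<close>

lemma P_cases: "x \<in> P \<longleftrightarrow> x = a \<or> x = b"
  using b_facts(1) by simp

lemma ex_c:
  obtains C where "C \<in> A" "\<And>C'. C' |\<in>| options C \<Longrightarrow> cls C' = \<one> \<or> cls C' = a"
    "cls C \<otimes> cls C = b" "b \<otimes> b = b" "cls C \<otimes> b \<noteq> b" "cls C \<otimes> b \<noteq> a \<otimes> b"
proof -
  obtain C C0 C1 where C: "C \<in> A" "C0 |\<in>| options C" "cls C0 = \<one>"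
    "C1 |\<in>| options C" "cls C1 = a"
    "\<And>C'. C' |\<in>| options C \<Longrightarrow> cls C' = \<one> \<or> cls C' = a"
    using ex_star2 by blast
  define c where "c = cls C"
  have c [simp]: "c \<in> carrier Q" using C(1) by (simp add: c_def)
  have move_one: "c \<otimes> w \<notin> P" if "w \<in> carrier Q" "w \<in> P" for w
    unfolding c_def using option_P[OF C(1,2) that(1)] that C(3) by simp
  have move_a: "c \<otimes> w \<notin> P" if "w \<in> carrier Q" "a \<otimes> w \<in> P" for w
    unfolding c_def using option_P[OF C(1,4) that(1)] that C(5) by simp
  \<comment> \<open>\<open>H\<close> is the sum of \<open>Suc n\<close> copies of \<open>C\<close>:
    a move in one copy turns the class of that copy into the unit or \<open>a\<close>.\<close>
  have multiple: "\<exists>H\<in>A. options H \<noteq> {||} \<and> cls H = c [^] Suc n \<and>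
      (\<forall>H'. H' |\<in>| options H \<longrightarrow> cls H' = c [^] n \<or> cls H' = a \<otimes> c [^] n)" for n
  proof (induction n)
    case 0
    have "options C \<noteq> {||}" using C(2) by auto
    then show ?case using C(1,6) by (intro bexI[of _ C]) (auto simp: c_def)
  next
    case (Suc n)
    then obtain H where H: "H \<in> A" "options H \<noteq> {||}" "cls H = c [^] Suc n"
      "\<And>H'. H' |\<in>| options H \<Longrightarrow> cls H' = c [^] n \<or> cls H' = a \<otimes> c [^] n"
      by blast
    have "cls K = c [^] Suc n \<or> cls K = a \<otimes> c [^] Suc n"
      if K: "K |\<in>| options (game_add H C)" for K
    proof -
      consider H' where "H' |\<in>| options H" "K = game_add H' C"
        | C' where "C' |\<in>| options C" "K = game_add H C'"
        using K unfolding option_game_add_iff by blast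
      then show ?thesis
      proof cases
        case 1
        then have "cls K = cls H' \<otimes> c" using C(1) H(1) by (simp add: cls_add option_in c_def)
        then show ?thesis using H(4)[OF 1(1)] by (auto simp: m_assoc)
      next
        case 2
        then have "cls K = c [^] Suc n \<otimes> cls C'"
          using C(1) H(1,3) by (metis cls_add option_in)
        then show ?thesis using C(6)[OF 2(1)] by (auto simp: m_comm)
      qed
    qed
    moreover have "options (game_add H C) \<noteq> {||}"
      using H(2) by (simp add: options_game_add)
    moreover have "cls (game_add H C) = c [^] Suc (Suc n)"
      using H(1,3) C(1) by (simp add: cls_add c_def)
    ultimately show ?case using H(1) C(1) add_in by blast
  qed
  have pow_P: "c [^] Suc n \<in> P" if "c [^] n \<notin> P" "a \<otimes> c [^] n \<notin> P" for n :: nat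
  proof -
    obtain H where H: "H \<in> A" "options H \<noteq> {||}" "cls H = c [^] Suc n"
      "\<And>H'. H' |\<in>| options H \<Longrightarrow> cls H' = c [^] n \<or> cls H' = a \<otimes> c [^] n"
      using multiple by blast
    then have "cls H' \<notin> P" if "H' |\<in>| options H" for H'
      using \<open>c [^] n \<notin> P\<close> \<open>a \<otimes> c [^] n \<notin> P\<close> that by metis
    then have "P_position H" using H(1,2) cls_P option_in by (metis P_position_iff)
    then show ?thesis using H cls_P by metis
  qed
  \<comment> \<open>Adding one copy of \<open>C\<close> to a P-position of class \<open>w\<close>
    gives an N-position, even with an extra factor \<open>a\<close>: a move in \<open>C\<close>
    restores \<open>w\<close>. Hence all options of the next even multiple are N-positions.\<close>
  have even: "c [^] Suc (Suc (2 * m)) \<in> P" for m :: nat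
  proof (induction m)
    case 0
    have "c \<notin> P" "a \<otimes> c \<notin> P"
      using move_a[of \<one>] move_one[of a] a_P by (simp_all add: m_comm)
    then show ?case using pow_P[of 1] by simp
  next
    case (Suc m)
    let ?w = "c [^] Suc (Suc (2 * m))"
    have w: "?w \<in> carrier Q" by (rule nat_pow_closed) simp
    have "c [^] Suc (2 * Suc m) = c \<otimes> ?w"
      using w by (simp add: m_comm)
    moreover have "c \<otimes> ?w \<notin> P" by (rule move_one[OF w Suc])
    moreover have "c \<otimes> (a \<otimes> ?w) \<notin> P" using move_a[of "a \<otimes> ?w"] w Suc by simp
    moreover have "a \<otimes> (c \<otimes> ?w) = c \<otimes> (a \<otimes> ?w)" using w by (simp only: m_lcomm a_closed c)
    ultimately show ?case using pow_P[of "Suc (2 * Suc m)"] by simp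
  qed
  \<comment> \<open>The square of \<open>a\<close> is the unit, which lies outside \<open>P\<close>.
    As the second and fourth powers have squares in \<open>P\<close>, both must equal
    \<open>b\<close>.\<close>
  have pow: "c [^] (2::nat) \<in> P" "c [^] (4::nat) \<in> P" "c [^] (8::nat) \<in> P"
    using even[of 0] even[of 1] even[of 3] by (simp_all add: eval_nat_numeral)
  have sq: "c [^] (4::nat) = c [^] (2::nat) \<otimes> c [^] (2::nat)"
    "c [^] (8::nat) = c [^] (4::nat) \<otimes> c [^] (4::nat)"
    by (simp_all add: nat_pow_mult)
  have "c [^] (2::nat) = b" "c [^] (4::nat) = b"
    using pow P_cases sq a_sq one_notin_P by metis+
  then have cc: "c \<otimes> c = b" and bb: "b \<otimes> b = b"
    using sq by (simp_all add: eval_nat_numeral)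
  have "c \<otimes> b \<noteq> b" using move_one[OF b_closed b_P] b_P by metis
  moreover have "c \<otimes> b \<noteq> a \<otimes> b"
  proof
    assume "c \<otimes> b = a \<otimes> b"
    then have "c \<otimes> (a \<otimes> b) = a \<otimes> (a \<otimes> b)" by (metis m_lcomm a_closed c b_closed)
    then show False using move_a[of "a \<otimes> b"] b_P by simp
  qed
  ultimately show ?thesis using that C(1,6) cc bb unfolding c_def by blast
qed

lemma b_idem: "b \<otimes> b = b"
  using ex_c by blast

section \<open>The group of multiples of \<open>b\<close>\<close>

lemma b_absorb [simp]: "x \<in> carrier Q \<Longrightarrow> x \<otimes> b \<otimes> b = x \<otimes> b"
  by (simp add: m_assoc b_idem)

lemma a_b_notin_P: "a \<otimes> b \<notin> P"
  using star_move b_P by blast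

lemma a_b_ne: "a \<otimes> b \<noteq> b"
  using a_b_notin_P b_P by metis

text \<open>The other element \<open>a\<close> of \<open>P\<close> is excluded: it would be fixed by
  \<open>b\<close>, whereas \<open>a \<otimes> b\<close> lies outside \<open>P\<close>.\<close>

lemma mult_b_P: "x \<in> carrier Q \<Longrightarrow> x \<otimes> b \<in> P \<Longrightarrow> x \<otimes> b = b"
  using P_cases b_absorb a_b_notin_P a_P by metis

lemma b_not_unit: "v \<in> carrier Q \<Longrightarrow> b \<otimes> v \<noteq> \<one>"
proof
  assume v: "v \<in> carrier Q" and "b \<otimes> v = \<one>"
  then have "b = b \<otimes> (b \<otimes> v)" by simp
  also have "\<dots> = b \<otimes> v" using v by (simp add: b_idem flip: m_assoc)
  finally show False using \<open>b \<otimes> v = \<one>\<close> b_ne_one by simp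
qed

text \<open>In a minimal counterexample \<open>X\<close>, the sum \<open>X + X + C + C\<close> can only be won by moving
  in \<open>C\<close>, which determines \<open>cls X \<otimes> cls X\<close> up to \<open>a\<close> and \<open>b\<close>; then \<open>X + X\<close> is itself a
  \<open>\<P>\<close>-position of the wrong class.\<close>

lemma sq_b:
  assumes "x \<in> carrier Q"
  shows "x \<otimes> x \<otimes> b = b"
proof -
  obtain C where C: "C \<in> A"
    "\<And>C'. C' |\<in>| options C \<Longrightarrow> cls C' = \<one> \<or> cls C' = a"
    "cls C \<otimes> cls C = b" "cls C \<otimes> b \<noteq> b" "cls C \<otimes> b \<noteq> a \<otimes> b"
    using ex_c by metis
  define c where "c = cls C"
  have c [simp]: "c \<in> carrier Q" using C(1) by (simp add: c_def)
  have "cls X \<otimes> cls X \<otimes> b = b" if "X \<in> A" for X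
    using that
  proof (induction "size X" arbitrary: X rule: less_induct)
    case (less X)
    define x where "x = cls X"
    have x [simp]: "x \<in> carrier Q" using less(2) by (simp add: x_def)
    show ?case
    proof (rule ccontr)
      assume "cls X \<otimes> cls X \<otimes> b \<noteq> b"
      then have neq: "x \<otimes> x \<otimes> b \<noteq> b" by (simp add: x_def)
      then have X0: "X \<noteq> zero_game" using cls_zero by (auto simp: x_def)
      \<comment> \<open>As \<open>X'\<close> is smaller,
        \<open>y \<otimes> y \<otimes> b = b\<close>; squaring
        \<open>y \<otimes> x \<otimes> b = b\<close> would then give
        \<open>x \<otimes> x \<otimes> b = b\<close>.\<close>
      have opt: "cls X' \<otimes> x \<otimes> b \<noteq> b" if X': "X' |\<in>| options X" for X'
      proof
        define y where "y = cls X'"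
        have y [simp]: "y \<in> carrier Q" using X' less(2) option_in by (auto simp: y_def)
        assume "cls X' \<otimes> x \<otimes> b = b"
        then have yx: "y \<otimes> x \<otimes> b = b" by (simp add: y_def)
        have yy: "y \<otimes> y \<otimes> b = b"
          using less X' option_in size_option by (simp add: y_def)
        have "b = (y \<otimes> x \<otimes> b) \<otimes> (y \<otimes> x \<otimes> b)" using yx b_idem by simp
        also have "\<dots> = (y \<otimes> y \<otimes> b) \<otimes> (x \<otimes> x \<otimes> b)" by (simp add: m_ac)
        also have "\<dots> = x \<otimes> x \<otimes> b" using yy by (simp add: m_ac b_idem)
        finally show False using neq by simp
      qed
      have opt_P: "cls X' \<otimes> x \<otimes> b \<notin> P" if X': "X' |\<in>| options X" for X'
        using opt[OF X'] mult_b_P[of "cls X' \<otimes> x"] X' less(2) option_in by auto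
      have XX: "game_add X X \<in> A" "cls (game_add X X) = x \<otimes> x"
        and CC: "game_add C C \<in> A" "cls (game_add C C) = b"
        using less(2) C(1,3) add_in by (auto simp: cls_add x_def)
      have optXX: "\<exists>X'. X' |\<in>| options X \<and> cls K = cls X' \<otimes> x"
        if "K |\<in>| options (game_add X X)" for K
        using that less(2) option_in by (auto simp: option_game_add_iff cls_add x_def m_comm)
      have optCC: "cls K = c \<or> cls K = a \<otimes> c" if "K |\<in>| options (game_add C C)" for K
      proof -
        have "\<exists>C'. C' |\<in>| options C \<and> cls K = cls C' \<otimes> c"
          using that C(1) option_in by (auto simp: option_game_add_iff cls_add c_def m_comm)
        then obtain C' where "C' |\<in>| options C" "cls K = cls C' \<otimes> c" by blast
        then show ?thesis using C(2)[of C'] by auto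
      qed
      have "x \<otimes> x \<otimes> b \<notin> P" using neq mult_b_P[of "x \<otimes> x"] by auto
      \<comment> \<open>The sum \<open>X + X + C + C\<close> is an N-position, and
        \<open>opt_P\<close> rules out every winning move in \<open>X + X\<close>.\<close>
      then have "\<exists>K. K |\<in>| options (game_add C C) \<and> x \<otimes> x \<otimes> cls K \<in> P"
        using outcome_iff[OF XX(1) CC(1)] X0 optXX opt_P unfolding XX(2) CC(2)
        by (metis options_eq_empty_iff options_game_add sup_eq_bot_iff fimage_is_fempty)
      then have "x \<otimes> x \<otimes> c \<in> P \<or> a \<otimes> (x \<otimes> x \<otimes> c) \<in> P"
        using optCC by (metis m_lcomm a_closed x c m_closed)
      then have "x \<otimes> x \<otimes> c \<in> {\<one>, a, b, a \<otimes> b}"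
        using a_a[of "x \<otimes> x \<otimes> c"] a_sq unfolding P_cases
        by (metis insertCI m_closed x c)
      then have xxcb: "x \<otimes> x \<otimes> c \<otimes> b = b \<or> x \<otimes> x \<otimes> c \<otimes> b = a \<otimes> b"
        using b_idem by auto
      \<comment> \<open>The value \<open>b\<close> is excluded by \<open>neq\<close>. The value
        \<open>a\<close> would make \<open>c \<otimes> b\<close> equal to \<open>b\<close> or
        \<open>a \<otimes> b\<close>, against the choice of \<open>C\<close>.\<close>
      have "x \<otimes> x \<notin> P"
      proof
        assume "x \<otimes> x \<in> P"
        moreover have "x \<otimes> x \<noteq> b" using neq b_idem by auto
        ultimately have "x \<otimes> x = a" by (simp add: P_cases)
        then have "a \<otimes> (c \<otimes> b) = b \<or> a \<otimes> (c \<otimes> b) = a \<otimes> b"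
          using xxcb by (simp add: m_assoc)
        then have "c \<otimes> b = a \<otimes> b \<or> c \<otimes> b = b"
          by (metis a_a m_closed c b_closed)
        then show False using C(4,5) by (simp add: c_def)
      qed
      then obtain X' where X': "X' |\<in>| options X" "cls X' \<otimes> x \<in> P"
        using outcome_iff[OF less(2) less(2)] X0 less(2) option_in m_comm cls_closed
        unfolding x_def by metis
      define y where "y = cls X'"
      have y [simp]: "y \<in> carrier Q" using X' less(2) option_in by (auto simp: y_def)
      have "y \<otimes> x \<noteq> b" using opt[OF X'(1)] b_idem by (auto simp: y_def)
      then have yx: "y \<otimes> x = a" using X'(2) by (simp add: P_cases y_def)
      have yy: "y \<otimes> y \<otimes> b = b"
        using less X' option_in size_option by (simp add: y_def)
      \<comment> \<open>The winning move in \<open>X + X\<close> leads to class \<open>a\<close>,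
        whose square is the unit; since \<open>b\<close> absorbs \<open>y \<otimes> y\<close>, it
        absorbs \<open>x \<otimes> x\<close> as well.\<close>
      have "b = (y \<otimes> x) \<otimes> (y \<otimes> x) \<otimes> b" using yx a_sq by simp
      also have "\<dots> = (y \<otimes> y \<otimes> b) \<otimes> (x \<otimes> x)" by (simp add: m_ac)
      also have "\<dots> = x \<otimes> x \<otimes> b" using yy by (simp add: m_ac)
      finally show False using neq by simp
    qed
  qed
  then show ?thesis using assms cls_surj by metis
qed

text \<open>By \<open>sq_b\<close>, the multiples of \<open>b\<close> form a group with identity
  \<open>b\<close> in which every element is its own inverse.\<close>

lemma cancel_b:
  assumes "x \<in> carrier Q" "y \<in> carrier Q" "x \<otimes> y \<otimes> b = b"
  shows "x \<otimes> b = y \<otimes> b"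
proof -
  have "x \<otimes> b = x \<otimes> (y \<otimes> y \<otimes> b)" using assms sq_b by simp
  also have "\<dots> = y \<otimes> (x \<otimes> y \<otimes> b)" using assms(1,2) by (simp add: m_ac)
  also have "\<dots> = y \<otimes> b" using assms(3) by simp
  finally show ?thesis .
qed

text \<open>Were the two equal, \<open>G\<close> and its option \<open>G'\<close> would both give
  P-positions when added to a game of class \<open>cls G \<otimes> b\<close>, by
  \<open>sq_b\<close>.\<close>

lemma option_b_ne:
  assumes "G \<in> A" "G' |\<in>| options G"
  shows "cls G' \<otimes> b \<noteq> cls G \<otimes> b"
proof
  assume eq: "cls G' \<otimes> b = cls G \<otimes> b"
  have G': "cls G' \<in> carrier Q" using assms option_in by blast
  have "cls G' \<otimes> (cls G' \<otimes> b) \<in> P" "cls G \<otimes> (cls G \<otimes> b) \<in> P"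
    using assms G' sq_b b_P by (simp_all flip: m_assoc)
  then show False using option_P[OF assms, of "cls G \<otimes> b"] eq assms by simp
qed

section \<open>Units and non-units\<close>

lemma unit_cases:
  assumes "u \<in> carrier Q" "v \<in> carrier Q" "u \<otimes> v = \<one>"
  shows "u = \<one> \<or> u = a"
proof -
  have "cls G = \<one> \<or> cls G = a" if "G \<in> A" "v \<in> carrier Q" "cls G \<otimes> v = \<one>" for G v
    using that
  proof (induction "size G" arbitrary: G v rule: less_induct)
    case (less G)
    define g where "g = cls G"
    have g [simp]: "g \<in> carrier Q" using less(2) by (simp add: g_def)
    note v [simp] = less(3)
    have gg: "g \<otimes> g \<otimes> b = b" by (simp add: sq_b)
    show ?case
    proof (cases "G = zero_game")
      case True
      then show ?thesis by (simp add: cls_zero)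
    next
      case False
      \<comment> \<open>\<open>G + G\<close> is an N-position: class \<open>b\<close> would make
        \<open>b\<close> a unit, and class \<open>a\<close> would contradict \<open>sq_b\<close>.
        The winning move then has \<open>h \<otimes> g = a\<close>, as \<open>option_b_ne\<close>
        excludes \<open>b\<close>, so \<open>h\<close> is a unit with inverse
        \<open>g \<otimes> a\<close> and induction applies to \<open>G'\<close>.\<close>
      have "g \<otimes> g \<noteq> b"
      proof
        assume "g \<otimes> g = b"
        then have "b \<otimes> (v \<otimes> v) = (g \<otimes> v) \<otimes> (g \<otimes> v)" by (simp add: m_ac flip: \<open>g \<otimes> g = b\<close>)
        then show False using less(4) b_not_unit[of "v \<otimes> v"] by (simp add: g_def)
      qed
      moreover have "g \<otimes> g \<noteq> a" using gg a_b_ne by auto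
      ultimately have "g \<otimes> g \<notin> P" by (simp add: P_cases)
      then obtain G' where G': "G' |\<in>| options G" "cls G' \<otimes> g \<in> P"
        using outcome_iff[OF less(2) less(2)] False less(2) option_in m_comm cls_closed
        unfolding g_def by metis
      define h where "h = cls G'"
      have h [simp]: "h \<in> carrier Q" using G' less(2) option_in by (auto simp: h_def)
      have "h \<otimes> g \<noteq> b"
        using option_b_ne[OF less(2) G'(1)] cancel_b[OF h g] b_idem by (auto simp: h_def g_def)
      then have hg: "h \<otimes> g = a" using G'(2) by (simp add: P_cases h_def)
      then have "h \<otimes> (g \<otimes> a) = \<one>" by (simp add: a_sq flip: m_assoc)
      then have "h = \<one> \<or> h = a"
        using less(1)[of G' "g \<otimes> a"] G'(1) less(2) option_in size_option by (simp add: h_def)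
      then have "g = a \<or> g = \<one>"
        using hg a_a[OF g] a_sq l_one[OF g] by metis
      then show ?thesis by (auto simp: g_def)
    qed
  qed
  then show ?thesis using assms cls_surj by metis
qed

text \<open>Since \<open>a\<close> is its own inverse, every factor of \<open>a\<close> is a
  unit.\<close>

lemma mult_a_cases:
  assumes "u \<in> carrier Q" "v \<in> carrier Q" "u \<otimes> v = a"
  shows "u = \<one> \<or> u = a"
  using assms unit_cases[of u "v \<otimes> a"] by (simp add: a_sq flip: m_assoc)

text \<open>A winning move in \<open>G\<close> would reach class \<open>a\<close>, making
  \<open>v\<close> a unit, or class \<open>b\<close>, giving
  \<open>cls G' \<otimes> b = u \<otimes> b\<close> against \<open>option_b_ne\<close>; likewise in
  \<open>H\<close>. So the sum is a P-position, and its class is not \<open>a\<close> because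
  \<open>u\<close> is no unit.\<close>

lemma mult_eq_b:
  assumes "u \<in> carrier Q" "v \<in> carrier Q" "u \<otimes> b = v \<otimes> b"
    and "u \<noteq> \<one>" "u \<noteq> a" "v \<noteq> \<one>" "v \<noteq> a"
  shows "u \<otimes> v = b"
proof -
  obtain G H where G: "G \<in> A" "cls G = u" and H: "H \<in> A" "cls H = v"
    using assms cls_surj by metis
  \<comment> \<open>Here \<open>w\<close> is the class of the summand left untouched; the fact
    serves for moves in either summand.\<close>
  have *: "cls G' \<otimes> w \<notin> P"
    if G: "G \<in> A" "G' |\<in>| options G"
      and w: "w \<in> carrier Q" "cls G \<otimes> b = w \<otimes> b" "w \<noteq> \<one>" "w \<noteq> a" for G G' w
  proof
    have G' [simp]: "cls G' \<in> carrier Q" using G option_in by blast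
    assume "cls G' \<otimes> w \<in> P"
    then consider "w \<otimes> cls G' = a" | "cls G' \<otimes> w = b" using w(1) by (auto simp: P_cases m_comm)
    then show False
    proof cases
      case 1
      then show ?thesis using mult_a_cases[OF w(1) G'] w by simp
    next
      case 2
      then have "cls G' \<otimes> b = w \<otimes> b" using cancel_b[OF G' w(1)] b_idem by simp
      then show ?thesis using option_b_ne[OF G] w(2) by simp
    qed
  qed
  have "u \<otimes> v \<in> P"
  proof (rule ccontr)
    assume "u \<otimes> v \<notin> P"
    moreover have "G \<noteq> zero_game" using G assms cls_zero by metis
    ultimately consider G' where "G' |\<in>| options G" "cls G' \<otimes> v \<in> P"
      | H' where "H' |\<in>| options H" "u \<otimes> cls H' \<in> P"
      using outcome_iff[OF G(1) H(1)] G(2) H(2) by auto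
    then show False
    proof cases
      case 1
      then show ?thesis using *[OF G(1) 1(1) assms(2)] G(2) assms by simp
    next
      case 2
      then show ?thesis
        using *[OF H(1) 2(1) assms(1)] H assms option_in m_comm cls_closed by metis
    qed
  qed
  then show ?thesis using mult_a_cases[OF assms(1,2)] assms by (auto simp: P_cases)
qed

text \<open>For a test element \<open>w\<close>, \<open>u \<otimes> w\<close> lies in
  \<open>P\<close> exactly if it equals \<open>b\<close>, as \<open>u\<close> is no unit. If
  \<open>u \<otimes> b \<otimes> w\<close> lies in \<open>P\<close>, then
  \<open>u \<otimes> b = w \<otimes> b\<close>, so \<open>w\<close> is neither the unit nor
  \<open>a\<close> and \<open>mult_eq_b\<close> applies. Reducedness concludes.\<close>

lemma mult_b_eq_self:
  assumes u: "u \<in> carrier Q" and "u \<otimes> b \<noteq> b" "u \<otimes> b \<noteq> a \<otimes> b"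
  shows "u \<otimes> b = u"
proof (rule reducedD)
  have u1: "u \<noteq> \<one>" "u \<noteq> a" using assms by auto
  fix w assume w: "w \<in> carrier Q"
  show "u \<otimes> b \<otimes> w \<in> P \<longleftrightarrow> u \<otimes> w \<in> P"
  proof
    assume "u \<otimes> w \<in> P"
    then have "u \<otimes> w = b" using mult_a_cases[OF u w] u1 by (auto simp: P_cases)
    moreover have "u \<otimes> b \<otimes> w = u \<otimes> w \<otimes> b" using u w by (simp add: m_ac)
    ultimately show "u \<otimes> b \<otimes> w \<in> P" using b_P b_idem by simp
  next
    assume "u \<otimes> b \<otimes> w \<in> P"
    then have "u \<otimes> w \<otimes> b \<in> P" using u w by (simp add: m_ac)
    then have "u \<otimes> w \<otimes> b = b" using u w mult_b_P by simp
    then have eq: "u \<otimes> b = w \<otimes> b" using cancel_b u w by blast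
    then have "w \<noteq> \<one>" "w \<noteq> a" using assms by auto
    then show "u \<otimes> w \<in> P" using mult_eq_b[OF u w eq u1] b_P by simp
  qed
qed (use u in auto)

lemma mult_absorbed:
  assumes "t \<in> carrier Q" "t \<otimes> b = b" "u \<in> carrier Q" "u \<otimes> b = u"
  shows "t \<otimes> u = u"
proof -
  have "t \<otimes> u = t \<otimes> (u \<otimes> b)" using assms by simp
  also have "\<dots> = u \<otimes> (t \<otimes> b)" using assms(1,3) by (simp add: m_ac)
  finally show ?thesis using assms by simp
qed

section \<open>Isomorphisms with the explicit multiplication tables\<close>

text \<open>The first part, where \<open>t\<close> is irrelevant, is meant to be used with \<open>t = b\<close>.\<close>

lemma elt_iso:
  assumes "1 \<le> k" and t: "t \<in> carrier Q" "t \<otimes> b = b" "t \<otimes> t = b"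
    and e: "\<And>i. i < 2 ^ k \<Longrightarrow> e i \<in> carrier Q" "e 0 = b" "e 1 = a \<otimes> b"
      "\<And>i j. i < 2 ^ k \<Longrightarrow> j < 2 ^ k \<Longrightarrow> e (xor i j) = e i \<otimes> e j"
    and inj: "inj_on e {..<2 ^ k}"
  defines "f \<equiv> \<lambda>u. case u of el_1 \<Rightarrow> \<one> | el_a \<Rightarrow> a | el_z i \<Rightarrow> e i | el_t \<Rightarrow> t | el_at \<Rightarrow> a \<otimes> t"
  shows "carrier Q = {\<one>, a} \<union> e ` {..<2 ^ k} \<Longrightarrow> Q \<cong>\<^sub>b\<^sub>m T_bm k"
    and "carrier Q = {\<one>, a, t, a \<otimes> t} \<union> e ` {..<2 ^ k} \<Longrightarrow> t \<noteq> \<one> \<Longrightarrow> t \<noteq> b \<Longrightarrow>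
      Q \<cong>\<^sub>b\<^sub>m R_bm k"
proof -
  \<comment> \<open>The index \<open>1\<close> must be in range, since multiplication by
    \<open>a\<close> acts on the \<open>e i\<close> as multiplication by \<open>e 1\<close>.\<close>
  have one_lt: "(1::nat) < 2 ^ k" and pos: "(0::nat) < 2 ^ k"
    using \<open>1 \<le> k\<close> one_less_power[of "2::nat" k] by simp_all
  note xor_lt = xor_less[of _ k]
  have eb: "e i \<otimes> b = e i" if "i < 2 ^ k" for i
    using e(4)[OF that pos] e(2) by simp
  have ae: "a \<otimes> e i = e (xor i 1)" if "i < 2 ^ k" for i
    using e(4)[OF that one_lt] e(1)[OF that] eb[OF that] e(3) by (simp add: m_lcomm)
  have te: "t \<otimes> e i = e i" if "i < 2 ^ k" for i
    using mult_absorbed t e(1) eb that by blast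
  have closed: "elt_mult u v \<in> carrier (R_bm k)"
    if "u \<in> carrier (R_bm k)" "v \<in> carrier (R_bm k)" for u v
    using that xor_lt one_lt by (cases u; cases v) (auto simp: R_bm_def T_bm_def)
  have closed_T: "elt_mult u v \<in> carrier (T_bm k)"
    if "u \<in> carrier (T_bm k)" "v \<in> carrier (T_bm k)" for u v
    using that xor_lt one_lt by (cases u; cases v) (auto simp: T_bm_def)
  have e1: "e (Suc 0) = a \<otimes> b" using e(3) by simp
  have ea: "e i \<otimes> a = e (xor i 1)" and et: "e i \<otimes> t = e i"
    and aea: "a \<otimes> t \<otimes> e i = e (xor i 1)" "e i \<otimes> (a \<otimes> t) = e (xor i 1)" if i: "i < 2 ^ k" for i
  proof -
    show "e i \<otimes> a = e (xor i 1)" using ae[OF i] e(1)[OF i] by (simp add: m_comm)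
    show "e i \<otimes> t = e i" using te[OF i] e(1)[OF i] t by (simp add: m_comm)
    show "a \<otimes> t \<otimes> e i = e (xor i 1)" using te[OF i] ae[OF i] e(1)[OF i] t by (simp add: m_assoc)
    then show "e i \<otimes> (a \<otimes> t) = e (xor i 1)" using e(1)[OF i] t by (simp add: m_comm)
  qed
  have "t \<otimes> (a \<otimes> t) = a \<otimes> b" using t m_lcomm[of t a t] by simp
  then have tat: "t \<otimes> (a \<otimes> t) = a \<otimes> b" "a \<otimes> t \<otimes> t = a \<otimes> b" "a \<otimes> t \<otimes> (a \<otimes> t) = b"
    "a \<otimes> t \<otimes> a = t" "t \<otimes> a = a \<otimes> t"
    using t m_comm[of t a] by (simp_all add: m_assoc)
  \<comment> \<open>The table of \<open>R_bm k\<close> extends that of \<open>T_bm k\<close>, so one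
    case distinction covers both maps.\<close>
  have hom: "f (elt_mult u v) = f u \<otimes> f v"
    if "u \<in> carrier (R_bm k)" "v \<in> carrier (R_bm k)" for u v
    using that t e(1,2,4) e1
    by (cases u; cases v) (auto simp: R_bm_def T_bm_def f_def a_sq ae ea te et aea tat)
  have clos: "f u \<in> carrier Q" if "u \<in> carrier (R_bm k)" for u
    using that t e(1) by (cases u) (auto simp: R_bm_def T_bm_def f_def)
  have sub: "carrier (T_bm k) \<subseteq> carrier (R_bm k)" by (auto simp: R_bm_def)
  \<comment> \<open>Each \<open>e i\<close> is fixed by \<open>b\<close>, whereas neither the unit
    nor \<open>a\<close> is.\<close>
  have e_ne: "e i \<noteq> \<one>" "e i \<noteq> a" if i: "i < 2 ^ k" for i
  proof -
    show "e i \<noteq> \<one>" using eb[OF i] b_not_unit[of \<one>] b_ne_one by auto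
    show "e i \<noteq> a" using eb[OF i] a_b_notin_P a_P by auto
  qed
  have inj_T: "inj_on f (carrier (T_bm k))"
  proof (rule inj_onI)
    fix u v
    assume "u \<in> carrier (T_bm k)" "v \<in> carrier (T_bm k)" "f u = f v"
    then show "u = v"
      by (cases u; cases v)
        (auto simp: T_bm_def f_def e_ne e_ne[symmetric] a_ne_one a_ne_one[symmetric]
          inj_on_eq_iff[OF inj])
  qed
  have mult: "mult (T_bm k) = elt_mult" "mult (R_bm k) = elt_mult"
    by (simp_all add: T_bm_def R_bm_def)
  have dist: "f ` distinguished (T_bm k) = distinguished Q"
    "f ` distinguished (R_bm k) = distinguished Q"
    by (simp_all add: T_bm_def R_bm_def f_def e(2) b_facts(1))
  have D: "distinguished (T_bm k) \<subseteq> carrier (T_bm k)"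
    "distinguished (R_bm k) \<subseteq> carrier (R_bm k)"
    by (auto simp: T_bm_def R_bm_def)
  have homs: "f \<in> hom (T_bm k) Q" "f \<in> hom (R_bm k) Q"
    unfolding hom_def mult using hom clos subsetD[OF sub] by simp_all
  show "Q \<cong>\<^sub>b\<^sub>m T_bm k" if Q: "carrier Q = {\<one>, a} \<union> e ` {..<2 ^ k}"
  proof (rule bm_isomorphicI[OF _ _ D(1) dist(1)])
    have "f ` carrier (T_bm k) = carrier Q"
      unfolding Q by (simp add: T_bm_def f_def image_Un image_image)
    then show "f \<in> iso (T_bm k) Q" using homs(1) inj_T by (simp add: iso_def bij_betw_def)
  qed (use closed_T mult in simp)
  show "Q \<cong>\<^sub>b\<^sub>m R_bm k"
    if Q: "carrier Q = {\<one>, a, t, a \<otimes> t} \<union> e ` {..<2 ^ k}" and "t \<noteq> \<one>" "t \<noteq> b"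
  proof -
    \<comment> \<open>Multiplying by \<open>b\<close> or by \<open>a\<close> reduces each
      coincidence to one already excluded.\<close>
    have ta: "t \<noteq> a" using t a_b_ne by auto
    have te_ne: "t \<noteq> e i" if "i < 2 ^ k" for i
      using eb[OF that] t \<open>t \<noteq> b\<close> by auto
    have at1: "a \<otimes> t \<noteq> \<one>" using a_a[OF t(1)] ta by auto
    have ata: "a \<otimes> t \<noteq> a" using a_a[OF t(1)] \<open>t \<noteq> \<one>\<close> a_sq by auto
    have ate: "a \<otimes> t \<noteq> e i" if "i < 2 ^ k" for i
      using a_a[OF t(1)] te_ne[OF xor_lt[OF that one_lt]] ae[OF that] by auto
    have att: "a \<otimes> t \<noteq> t" using t a_b_ne by (metis a_closed b_closed m_assoc)
    note ne = e_ne a_ne_one te_ne at1 ata ate att ta \<open>t \<noteq> \<one>\<close>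
    have "inj_on f (carrier (R_bm k))"
    proof (rule inj_onI)
      fix u v
      assume "u \<in> carrier (R_bm k)" "v \<in> carrier (R_bm k)" "f u = f v"
      then show "u = v"
        by (cases u; cases v)
          (auto simp: R_bm_def T_bm_def f_def inj_on_eq_iff[OF inj] ne ne[symmetric])
    qed
    moreover have "f ` carrier (R_bm k) = carrier Q"
      unfolding Q by (simp add: T_bm_def R_bm_def f_def image_Un image_image) blast
    ultimately have "f \<in> iso (R_bm k) Q" using homs(2) by (simp add: iso_def bij_betw_def)
    then show ?thesis
      using closed mult by (intro bm_isomorphicI[OF _ _ D(2) dist(2)]) simp_all
  qed
qed

end

section \<open>One-stage extensions\<close>

text \<open>\<open>\<phi>\<close> is the reduction map of \<open>S\<close> followed by the
  isomorphism onto \<open>T_bm n\<close>; a priori it may identify elements of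
  \<open>S\<close>.\<close>

locale T_extension = two_P_quotient +
  fixes n :: nat and S :: "'a set" and \<phi> :: "'a \<Rightarrow> elt"
  assumes n: "1 \<le> n"
    and S: "submonoid S Q"
    and phi: "bm_epi \<phi> (sub_bm Q S) (T_bm n)"
begin

section \<open>The submonoid reducing to \<open>T_bm n\<close>\<close>

lemma
  shows S_carrier: "s \<in> S \<Longrightarrow> s \<in> carrier Q"
    and S_mult: "s \<in> S \<Longrightarrow> s' \<in> S \<Longrightarrow> s \<otimes> s' \<in> S"
    and S_one: "\<one> \<in> S"
  using S by (auto simp: submonoid_def)

lemma
  shows phi_surj: "\<phi> ` S = carrier (T_bm n)"
    and phi_one: "\<phi> \<one> = el_1"
    and phi_mult: "s \<in> S \<Longrightarrow> s' \<in> S \<Longrightarrow> \<phi> (s \<otimes> s') = elt_mult (\<phi> s) (\<phi> s')"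
    and phi_P: "s \<in> S \<Longrightarrow> \<phi> s = el_a \<or> \<phi> s = el_z 0 \<longleftrightarrow> s \<in> P"
  using phi by (auto simp: bm_epi_def sub_bm_def T_bm_def)

text \<open>Preimages of \<open>el_a\<close> and \<open>el_z 0\<close> are distinct elements of
  \<open>P\<close>, hence \<open>a\<close> and \<open>b\<close> in some order. The order is settled
  by idempotence, as \<open>b\<close> is idempotent and \<open>el_a\<close> is not.\<close>

lemma a_b_in_S: "a \<in> S" "b \<in> S" and phi_a: "\<phi> a = el_a" and phi_b: "\<phi> b = el_z 0"
proof -
  have "el_a \<in> \<phi> ` S" "el_z 0 \<in> \<phi> ` S" unfolding phi_surj by (auto simp: T_bm_def)
  then obtain p q where pq: "p \<in> S" "\<phi> p = el_a" "q \<in> S" "\<phi> q = el_z 0" by force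
  then have "p \<in> P" "q \<in> P" "p \<noteq> q" using phi_P by auto
  then have *: "p = a \<and> q = b \<or> p = b \<and> q = a" by (auto simp: P_cases)
  then show ab: "a \<in> S" "b \<in> S" using pq by auto
  have "\<phi> b \<noteq> el_a" using phi_mult[OF ab(2) ab(2)] b_idem by auto
  then show "\<phi> a = el_a" "\<phi> b = el_z 0" using * pq by auto
qed

text \<open>As \<open>P\<close> has two elements, \<open>a\<close> and \<open>b\<close> are the only
  preimages of \<open>el_a\<close> and \<open>el_z 0\<close>; multiplying by \<open>a\<close> gives
  uniqueness above \<open>el_1\<close> and \<open>el_z 1\<close> too. Any other \<open>s\<close>
  maps to a \<open>z\<close> of larger index, so \<open>s \<otimes> b\<close> is neither
  \<open>b\<close> nor \<open>a \<otimes> b\<close> and \<open>mult_b_eq_self\<close>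
  applies.\<close>

lemma S_cases:
  assumes s: "s \<in> S"
  shows "s = \<one> \<or> s = a \<or> s \<otimes> b = s"
proof -
  note [simp] = S_carrier[OF s]
  have as: "\<phi> (a \<otimes> s) = elt_mult el_a (\<phi> s)" "a \<otimes> s \<in> S"
    using s a_b_in_S S_mult phi_mult phi_a by auto
  have sb: "\<phi> (s \<otimes> b) = elt_mult (\<phi> s) (el_z 0)"
    using s a_b_in_S phi_mult phi_b by auto
  have P: "x = a" if "x \<in> S" "\<phi> x = el_a" for x
    using that phi_P[of x] phi_b P_cases[of x] by auto
  have P0: "x = b" if "x \<in> S" "\<phi> x = el_z 0" for x
    using that phi_P[of x] phi_a P_cases[of x] by auto
  have "\<phi> s \<in> carrier (T_bm n)" using s phi_surj by blast
  then consider "\<phi> s = el_1" | "\<phi> s = el_a" | i where "\<phi> s = el_z i"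
    by (auto simp: T_bm_def)
  then show ?thesis
  proof cases
    case 1
    then have "\<phi> (a \<otimes> s) = el_a" using as(1) by simp
    then have "a \<otimes> s = a" using P as(2) by blast
    then show ?thesis using a_a[OF S_carrier[OF s]] a_sq by metis
  next
    case 2
    then show ?thesis using P s by blast
  next
    case 3
    have "s \<otimes> b = s" if "s \<otimes> b = b"
    proof -
      have "\<phi> s = el_z 0" using sb 3 that phi_b by simp
      then have "s = b" by (rule P0[OF s])
      then show ?thesis using b_idem by simp
    qed
    moreover have "s \<otimes> b = s" if *: "s \<otimes> b = a \<otimes> b"
    proof -
      have "\<phi> (a \<otimes> b) = el_z 1" using phi_mult a_b_in_S phi_a phi_b by simp
      then have "\<phi> s = el_z 1" using sb 3 * by simp
      then have "\<phi> (a \<otimes> s) = el_z 0" using as(1) by simp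
      then have "a \<otimes> s = b" using P0 as(2) by blast
      then have "s = a \<otimes> b" using a_a[OF S_carrier[OF s]] by metis
      then show ?thesis using * by metis
    qed
    ultimately show ?thesis using mult_b_eq_self[OF S_carrier[OF s]] by blast
  qed
qed

text \<open>Since \<open>\<phi>\<close> is injective on \<open>S\<close>, \<open>e i\<close> is the unique preimage of \<open>z\<^sub>i\<close>, for \<open>i < 2 ^ n\<close>.\<close>

definition e :: "nat \<Rightarrow> 'a" where "e i = inv_into S \<phi> (el_z i)"

lemma e_in: "i < 2 ^ n \<Longrightarrow> e i \<in> S" and phi_e: "i < 2 ^ n \<Longrightarrow> \<phi> (e i) = el_z i"
proof -
  assume "i < 2 ^ n"
  then have "el_z i \<in> \<phi> ` S" unfolding phi_surj by (simp add: T_bm_def)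
  then show "e i \<in> S" "\<phi> (e i) = el_z i"
    unfolding e_def by (simp_all add: inv_into_into f_inv_into_f)
qed

lemma e_b: "i < 2 ^ n \<Longrightarrow> e i \<otimes> b = e i"
  using S_cases[OF e_in] phi_e phi_one phi_a by (metis elt.distinct(3,9))

text \<open>The product \<open>e i \<otimes> s\<close> lies above \<open>el_z 0\<close>, so it is
  \<open>b\<close>; then \<open>cancel_b\<close> identifies the two factors, both being fixed by
  \<open>b\<close>.\<close>

lemma e_eqI:
  assumes s: "s \<in> S" "\<phi> s = el_z i" and i: "i < 2 ^ n"
  shows "e i = s"
proof -
  have sb: "s \<otimes> b = s" using S_cases[OF s(1)] s phi_one phi_a by auto
  have "\<phi> (e i \<otimes> s) = el_z 0" using phi_mult e_in phi_e s i by simp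
  then have "e i \<otimes> s = b"
    using phi_P[of "e i \<otimes> s"] S_mult e_in s i phi_a by (auto simp: P_cases)
  then have "e i \<otimes> b = s \<otimes> b" using cancel_b[of "e i" s] S_carrier e_in s i b_idem by simp
  then show ?thesis using sb e_b[OF i] by simp
qed

lemma e_xor: "i < 2 ^ n \<Longrightarrow> j < 2 ^ n \<Longrightarrow> e (xor i j) = e i \<otimes> e j"
  by (intro e_eqI) (simp_all add: S_mult phi_mult e_in phi_e xor_less)

lemma e_0: "e 0 = b"
  by (intro e_eqI) (simp_all add: a_b_in_S phi_b)

lemma e_1: "e 1 = a \<otimes> b"
proof (rule e_eqI)
  show "a \<otimes> b \<in> S" by (rule S_mult[OF a_b_in_S])
  show "\<phi> (a \<otimes> b) = el_z 1" by (simp add: a_b_in_S phi_a phi_b phi_mult)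
  show "1 < (2::nat) ^ n" using n by (intro one_less_power) simp_all
qed

lemma inj_e: "inj_on e {..<2 ^ n}"
  by (rule inj_onI) (metis phi_e elt.inject lessThan_iff)

text \<open>By \<open>S_cases\<close>, an element other than the unit and \<open>a\<close> is fixed
  by \<open>b\<close>, so its image is some \<open>z\<close> and it is one of the
  \<open>e i\<close>. Thus \<open>S\<close> is a copy of \<open>T_bm n\<close>: the reduction
  collapses nothing.\<close>

lemma S_eq: "S = {\<one>, a} \<union> e ` {..<2 ^ n}"
proof
  show "{\<one>, a} \<union> e ` {..<2 ^ n} \<subseteq> S" using S_one a_b_in_S e_in by auto
  show "S \<subseteq> {\<one>, a} \<union> e ` {..<2 ^ n}"
  proof
    fix s assume s: "s \<in> S"
    show "s \<in> {\<one>, a} \<union> e ` {..<2 ^ n}"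
    proof (cases "s = \<one> \<or> s = a")
      case False
      then have "s \<otimes> b = s" using S_cases[OF s] by blast
      then have "\<phi> s = elt_mult (\<phi> s) (el_z 0)" using phi_mult[OF s a_b_in_S(2)] phi_b by simp
      moreover have "\<phi> s \<in> carrier (T_bm n)" using s phi_surj by blast
      ultimately obtain i where "i < 2 ^ n" "\<phi> s = el_z i" by (auto simp: T_bm_def)
      then show ?thesis using e_eqI[OF s] by auto
    qed auto
  qed
qed

section \<open>Adjoining the new generator\<close>

lemma generated_le:
  assumes "generated_submonoid Q (S \<union> {x}) = carrier Q"
    and "S \<subseteq> H" "x \<in> H" "H \<subseteq> carrier Q"
    and "\<And>u v. u \<in> H \<Longrightarrow> v \<in> H \<Longrightarrow> u \<otimes> v \<in> H"
  shows "carrier Q = H"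
proof -
  have "submonoid H Q" using assms S_one by (intro submonoid.intro) auto
  then have "generated_submonoid Q (S \<union> {x}) \<subseteq> H"
    using assms(2,3) by (auto simp: generated_submonoid_def)
  then show ?thesis using assms by blast
qed

text \<open>Here \<open>x\<close> is a multiple of \<open>b\<close> outside the subgroup of the
  \<open>e i\<close>. As \<open>x \<otimes> x = b\<close>, adjoining it doubles this subgroup, which
  adds one bit to the index.\<close>

lemma extension_T:
  assumes gen: "generated_submonoid Q (S \<union> {x}) = carrier Q"
    and x: "x \<in> carrier Q" "x \<notin> S" "x \<otimes> b = x"
  shows "Q \<cong>\<^sub>b\<^sub>m T_bm (n + 1)"
proof -
  \<comment> \<open>bit \<open>n\<close> of the index records membership in the coset of \<open>x\<close>\<close>
  define y where "y i = (if bit i n then x else b)" for i :: nat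
  define e' where "e' i = e (take_bit n i) \<otimes> y i" for i
  have xx: "x \<otimes> x = b" using sq_b[OF x(1)] x by (simp add: m_assoc)
  have bx: "b \<otimes> x = x" using x by (simp add: m_comm)
  have tb: "take_bit n i < 2 ^ n" for i :: nat by simp
  have ec: "e (take_bit n i) \<in> carrier Q" for i using e_in[OF tb] S_carrier by blast
  have yc: "y i \<in> carrier Q" for i using x by (simp add: y_def)
  \<comment> \<open>Bit \<open>n\<close> of \<open>xor i j\<close> is set iff exactly one of the two
    bits is, matching \<open>x \<otimes> x = b\<close> and \<open>b \<otimes> x = x\<close>.\<close>
  have yy: "y (xor i j) = y i \<otimes> y j" for i j
    using xx bx x b_idem by (simp add: y_def bit_xor_iff)
  have y_sq: "y i \<otimes> y i = b" for i using xx b_idem by (simp add: y_def)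
  have e'_xor: "e' (xor i j) = e' i \<otimes> e' j" for i j
    using ec yc e_xor[OF tb tb, of i j] by (simp add: e'_def yy m_ac)
  have small: "e' i = e i" if "i < 2 ^ n" for i
  proof -
    have "take_bit n i = i" using that by (simp add: take_bit_nat_eq_self)
    moreover have "\<not> bit i n" using that by (simp add: bit_iff_odd)
    ultimately show ?thesis using e_b[OF that] by (simp add: e'_def y_def)
  qed
  have large: "e' (2 ^ n + i) = e i \<otimes> x" if "i < 2 ^ n" for i
  proof -
    have "take_bit n (2 ^ n + i) = i" using that by (simp add: take_bit_eq_mod)
    moreover have "bit (2 ^ n + i) n" using that by (simp add: bit_iff_odd)
    ultimately show ?thesis by (simp add: e'_def y_def)
  qed
  have inj: "inj_on e' {..<2 ^ (n + 1)}"
  proof (rule inj_onI)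
    fix i j :: nat
    assume ij: "i \<in> {..<2 ^ (n + 1)}" "j \<in> {..<2 ^ (n + 1)}" and eq: "e' i = e' j"
    have cancel: "e' i \<otimes> y i = e (take_bit n i)" for i
      using ec yc e_b[OF tb] by (simp add: e'_def m_assoc y_sq)
    have bits: "bit i n \<longleftrightarrow> bit j n"
    proof (rule ccontr)
      \<comment> \<open>An equality across the two cosets, multiplied by the self-inverse factor
        \<open>e (take_bit n i)\<close>, would put \<open>x\<close> into \<open>S\<close>.\<close>
      have *: False if "e' i = e' j" "bit i n" "\<not> bit j n" for i j
      proof -
        have "e (take_bit n i) \<otimes> x = e (take_bit n j)"
          using that e_b[OF tb] by (simp add: e'_def y_def)
        then have "e (take_bit n i) \<otimes> (e (take_bit n i) \<otimes> x) \<in> S"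
          using S_mult[OF e_in[OF tb] e_in[OF tb]] by simp
        moreover have "e (take_bit n i) \<otimes> e (take_bit n i) = b"
          using e_xor[OF tb tb, of i i] e_0 by simp
        moreover have "e (take_bit n i) \<otimes> (e (take_bit n i) \<otimes> x) =
            e (take_bit n i) \<otimes> e (take_bit n i) \<otimes> x"
          using m_assoc[OF ec ec x(1)] by simp
        ultimately show False using x(2) bx by metis
      qed
      assume "bit i n \<noteq> bit j n"
      then show False using * eq by metis
    qed
    then have "e (take_bit n i) = e (take_bit n j)"
      using eq cancel[of i] cancel[of j] by (simp add: y_def)
    then have "take_bit n i = take_bit n j" using inj_e tb by (auto dest: inj_onD)
    then have "take_bit (Suc n) i = take_bit (Suc n) j"
      using bits by (simp add: take_bit_Suc_from_most)
    then show "i = j" using ij by (simp add: take_bit_nat_eq_self)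
  qed
  have range: "e' ` {..<2 ^ (n + 1)} = e ` {..<2 ^ n} \<union> (\<lambda>i. e i \<otimes> x) ` {..<2 ^ n}"
  proof -
    have "{..<2 ^ (n + 1)} = {..<2 ^ n} \<union> (+) (2 ^ n) ` {..<2 ^ n :: nat}"
    proof (intro equalityI subsetI)
      fix i :: nat
      assume "i \<in> {..<2 ^ (n + 1)}"
      then have "i < 2 ^ n \<or> i = 2 ^ n + (i - 2 ^ n) \<and> i - 2 ^ n < 2 ^ n" by auto
      then show "i \<in> {..<2 ^ n} \<union> (+) (2 ^ n) ` {..<2 ^ n}" by blast
    qed auto
    then show ?thesis using small large by (simp add: image_Un image_image)
  qed
  have e'c: "e' i \<in> carrier Q" for i using ec yc by (simp add: e'_def)
  have e'0: "e' 0 = b" using small e_0 by simp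
  have e'1: "e' 1 = a \<otimes> b" using small[of 1] e_1 n one_less_power[of "2::nat" n] by simp
  have one_lt: "(1::nat) < 2 ^ (n + 1)" by (rule one_less_power) simp_all
  have e'b: "e' i \<otimes> b = e' i" for i using e'_xor[of i 0] e'0 by simp
  have ae': "a \<otimes> e' i = e' (xor i 1)" "e' i \<otimes> a = e' (xor i 1)" for i
  proof -
    have "e' i \<otimes> (a \<otimes> b) = e' (xor i 1)" unfolding e'_xor e'1 ..
    moreover have "e' i \<otimes> (a \<otimes> b) = a \<otimes> (e' i \<otimes> b)" using e'c by (simp add: m_lcomm)
    ultimately show "a \<otimes> e' i = e' (xor i 1)" using e'b by simp
    then show "e' i \<otimes> a = e' (xor i 1)" using e'c m_comm by simp
  qed
  have xor_lt: "xor i j < 2 ^ (n + 1)" if "i < 2 ^ (n + 1)" "j < 2 ^ (n + 1)" for i j :: nat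
    using that by (rule xor_less)
  have Q: "carrier Q = {\<one>, a} \<union> e' ` {..<2 ^ (n + 1)}"
  proof (rule generated_le[OF gen])
    show "S \<subseteq> {\<one>, a} \<union> e' ` {..<2 ^ (n + 1)}" unfolding range using S_eq by blast
    have "x = e 0 \<otimes> x" using e_0 bx by simp
    then show "x \<in> {\<one>, a} \<union> e' ` {..<2 ^ (n + 1)}" unfolding range by auto
    show "{\<one>, a} \<union> e' ` {..<2 ^ (n + 1)} \<subseteq> carrier Q" using e'c by auto
    show "u \<otimes> v \<in> {\<one>, a} \<union> e' ` {..<2 ^ (n + 1)}"
      if u: "u \<in> {\<one>, a} \<union> e' ` {..<2 ^ (n + 1)}"
        and v: "v \<in> {\<one>, a} \<union> e' ` {..<2 ^ (n + 1)}" for u v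
    proof -
      let ?H = "{\<one>, a} \<union> e' ` {..<2 ^ (n + 1)}"
      have K: "e' i \<otimes> e' j \<in> ?H" if "i < 2 ^ (n + 1)" "j < 2 ^ (n + 1)" for i j
        using xor_lt[OF that] e'_xor[of i j] by (metis UnI2 imageI lessThan_iff)
      have A: "a \<otimes> e' i \<in> ?H" "e' i \<otimes> a \<in> ?H" if "i < 2 ^ (n + 1)" for i
        using xor_lt[OF that one_lt] ae'[of i] by (metis UnI2 imageI lessThan_iff)+
      have v': "v \<in> carrier Q" using v e'c by blast
      consider "u = \<one>" | "u = a" | i where "i < 2 ^ (n + 1)" "u = e' i" using u by blast
      then show ?thesis
      proof cases
        case 1
        then show ?thesis using v v' by (metis l_one)
      next
        case 2
        consider "v = \<one>" | "v = a" | j where "j < 2 ^ (n + 1)" "v = e' j" using v by blast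
        then show ?thesis
          by cases (use 2 A a_sq in simp_all)
      next
        case 3
        consider "v = \<one>" | "v = a" | j where "j < 2 ^ (n + 1)" "v = e' j" using v by blast
        then show ?thesis
          by cases (use 3 A K u e'c in simp_all)
      qed
    qed
  qed
  show ?thesis
  proof (rule elt_iso(1)[OF _ b_closed b_idem b_idem _ e'0 e'1 _ inj Q])
    show "1 \<le> n + 1" by simp
    show "e' i \<in> carrier Q" for i by (rule e'c)
    show "e' (xor i j) = e' i \<otimes> e' j" for i j by (rule e'_xor)
  qed
qed

lemma extension_R:
  assumes gen: "generated_submonoid Q (S \<union> {x}) = carrier Q"
    and x: "x \<in> carrier Q" "x \<notin> S" "x \<otimes> b \<noteq> x"
  shows "Q \<cong>\<^sub>b\<^sub>m R_bm n"
proof -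
  have xb: "x \<otimes> b = b \<or> x \<otimes> b = a \<otimes> b" using mult_b_eq_self x by blast
  \<comment> \<open>Passing to \<open>a \<otimes> x\<close> when
    \<open>x \<otimes> b = a \<otimes> b\<close> ensures \<open>t \<otimes> b = b\<close>; since
    \<open>a\<close> is in \<open>S\<close> and \<open>a \<otimes> a\<close> is the unit,
    \<open>x\<close> can be recovered from \<open>t\<close>.\<close>
  define t where "t = (if x \<otimes> b = b then x else a \<otimes> x)"
  have t [simp]: "t \<in> carrier Q" using x by (simp add: t_def)
  have tb: "t \<otimes> b = b" 
  proof (cases "x \<otimes> b = b")
    case False
    then have "x \<otimes> b = a \<otimes> b" using xb by blast
    then show ?thesis using False x(1) by (simp add: t_def m_assoc)
  qed (simp add: t_def)
  have xt: "x = t \<or> x = a \<otimes> t" using x(1) by (simp add: t_def)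
  then have tS: "t \<notin> S" using x(2) S_mult a_b_in_S by blast
  then have t1: "t \<noteq> \<one>" "t \<noteq> b" "t \<noteq> a" using S_one a_b_in_S by blast+
  \<comment> \<open>\<open>mult_eq_b\<close> with both factors equal to \<open>t\<close>, which is
    no unit.\<close>
  then have tt: "t \<otimes> t = b" using mult_eq_b[OF t t refl] by blast
  have ec: "e i \<in> carrier Q" if "i < 2 ^ n" for i using e_in[OF that] S_carrier by blast
  have te: "t \<otimes> e i = e i" if "i < 2 ^ n" for i
    using mult_absorbed[OF t tb] ec e_b that by blast
  have st: "t \<otimes> s \<in> S \<union> {t, a \<otimes> t}" "a \<otimes> t \<otimes> s \<in> S \<union> {t, a \<otimes> t}" if s: "s \<in> S" for s
  proof -
    consider "s = \<one>" | "s = a" | i where "i < 2 ^ n" "s = e i" using s S_eq by blast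
    then have "t \<otimes> s \<in> S \<union> {t, a \<otimes> t} \<and> a \<otimes> t \<otimes> s \<in> S \<union> {t, a \<otimes> t}"
    proof cases
      case 2
      then show ?thesis by (simp add: m_assoc m_comm[of t a])
    next
      case 3
      then show ?thesis using te s S_mult a_b_in_S by (simp add: m_assoc ec)
    qed auto
    then show "t \<otimes> s \<in> S \<union> {t, a \<otimes> t}" "a \<otimes> t \<otimes> s \<in> S \<union> {t, a \<otimes> t}" by auto
  qed
  have "carrier Q = S \<union> {t, a \<otimes> t}"
  proof (rule generated_le[OF gen])
    show "S \<subseteq> S \<union> {t, a \<otimes> t}" by blast
    show "x \<in> S \<union> {t, a \<otimes> t}" using xt by blast
    show "S \<union> {t, a \<otimes> t} \<subseteq> carrier Q" using S_carrier by auto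
    have "t \<otimes> (a \<otimes> t) = a \<otimes> b" using tt m_lcomm[of t a t] by simp
    then have *: "t \<otimes> t = b" "t \<otimes> (a \<otimes> t) = a \<otimes> b" "a \<otimes> t \<otimes> t = a \<otimes> b"
      "a \<otimes> t \<otimes> (a \<otimes> t) = b"
      by (simp_all add: tt m_assoc)
    have "a \<otimes> b \<in> S" using S_mult a_b_in_S by blast
    then show "u \<otimes> v \<in> S \<union> {t, a \<otimes> t}"
      if uv: "u \<in> S \<union> {t, a \<otimes> t}" "v \<in> S \<union> {t, a \<otimes> t}" for u v
    proof -
      consider "u \<in> S" "v \<in> S" | "u \<in> {t, a \<otimes> t}" "v \<in> S" | "u \<in> S" "v \<in> {t, a \<otimes> t}"
        | "u \<in> {t, a \<otimes> t}" "v \<in> {t, a \<otimes> t}"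
        using uv by blast
      then show ?thesis
      proof cases
        case 1
        then show ?thesis using S_mult by blast
      next
        case 2
        then show ?thesis using st by blast
      next
        case 3
        then have "u \<otimes> v = v \<otimes> u" using S_carrier m_comm by auto
        then show ?thesis using st 3 by auto
      next
        case 4
        then show ?thesis using * \<open>a \<otimes> b \<in> S\<close> a_b_in_S by auto
      qed
    qed
  qed
  also have "\<dots> = {\<one>, a, t, a \<otimes> t} \<union> e ` {..<2 ^ n}" using S_eq by blast
  finally have Q: "carrier Q = {\<one>, a, t, a \<otimes> t} \<union> e ` {..<2 ^ n}" .
  show ?thesis
  proof (rule elt_iso(2)[OF n t tb tt _ e_0 e_1 _ inj_e Q t1(1,2)])
    show "e i \<in> carrier Q" if "i < 2 ^ n" for i by (rule ec[OF that])
    show "e (xor i j) = e i \<otimes> e j" if "i < 2 ^ n" "j < 2 ^ n" for i j by (rule e_xor[OF that])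
  qed
qed

end

theorem theorem4p1:
  fixes Q :: "'a bipartite_monoid" and n :: nat
  assumes "n \<ge> 2"
    and "misere_quotient Q"
    and "one_stage_extension (T_bm n) Q"
    and "card (distinguished Q) = 2"
  shows "Q \<cong>\<^sub>b\<^sub>m T_bm (n + 1) \<or> Q \<cong>\<^sub>b\<^sub>m R_bm n"
proof -
  obtain A cls where A: "closed_games A" "bm_epi cls (games_bm A) Q"
    using misere_quotient_epi[OF assms(2)] by blast
  obtain S x where S: "submonoid S Q" "reduction (sub_bm Q S) \<cong>\<^sub>b\<^sub>m T_bm n"
    and x: "x \<in> carrier Q" "x \<notin> S" "generated_submonoid Q (S \<union> {x}) = carrier Q"
    and red: "reduced Q" "reduced (T_bm n)"
    using assms(3) by (auto simp: one_stage_extension_def)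
  have Q: "comm_monoid Q" and T: "comm_monoid (T_bm n)"
    using red by (auto simp: reduced_def bipartite_monoid_def)
  interpret comm_monoid Q by (rule Q)
  have "comm_monoid (sub_bm Q S)"
    using S(1) submonoid.subset[OF S(1)]
    by (intro comm_monoidI) (auto simp: sub_bm_def submonoid_def subset_iff intro: m_assoc m_comm)
  then obtain \<phi> where phi: "bm_epi \<phi> (sub_bm Q S) (T_bm n)"
    using reduction_epi[OF _ _ T S(2)] by (auto simp: sub_bm_def)
  then interpret T_extension Q A cls n S \<phi>
    using assms(1,4)
    by (intro T_extension.intro two_P_quotient.intro two_P_quotient_axioms.intro
        T_extension_axioms.intro Q A red S(1) phi) simp_all
  show ?thesis
  \<comment> \<open>The two outcomes are separated by whether \<open>x\<close> belongs to the group
    of multiples of \<open>b\<close>.\<close>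
  proof (cases "x \<otimes>\<^bsub>Q\<^esub> b = x")
    case True
    then show ?thesis using extension_T[OF x(3,1,2)] by simp
  next
    case False
    then show ?thesis using extension_R[OF x(3,1,2)] by simp
  qed
qed

end
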